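(* Let $m$ be any positive rational number and let $\Lambda=\left(\sqrt{2}\,g_{3m}\,g_{m/3}\right)^3$. Then $$\frac{a_{m,3}}{b_{4m,3}}-\frac{b_{4m,3}}{a_{m,3}}=\Lambda,\qquad \frac{1}{a_{m,3}b_{4m,3}}-a_{m,3}b_{4m,3}=\frac{1}{9}\cdot\frac{\Lambda^4+11\Lambda^2-8}{\Lambda}.$$
   Context: For $|q|<1$: $\varphi(q)=\sum_{n\in\mathbb Z}q^{n^2}$, $\psi(q)=\sum_{n\ge0}q^{n(n+1)/2}$, $(a;q)_\infty=\prod_{k\ge0}(1-aq^k)$, $\chi(q)=(-q;q^2)_\infty$. For positive rational $r$, the Ramanujan class invariant is $g_r=2^{-1/4}q^{-1/24}\chi(-q)$ with $q=e^{-\pi\sqrt r}$. For positive rationals $m,n$, Ramanujan's remarkable product of theta functions is $$a_{m,n}=\frac{n\,q^{(n-1)/4}\psi^2(q^n)\varphi^2(-q^{2n})}{\psi^2(q)\varphi^2(-q^2)},\quad q=e^{-\pi\sqrt{m/n}},$$ and $$b_{m,n}=\frac{n\,q^{(n-1)/4}\psi^2(q^n)\varphi^2(-q^{n})}{\psi^2(q)\varphi^2(-q)},\quad q=e^{-\pi\sqrt{m/n}}.$$ *)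

theory Defs
  imports "HOL-Analysis.Analysis"
begin

text \<open>
  The theta functions and the infinite product are meant for \<open>norm q < 1\<close>; being polymorphic,
  they cover both real and complex \<open>q\<close>.
\<close>

definition ramanujan_phi :: "'a::{real_normed_field,banach} \<Rightarrow> 'a" where
  "ramanujan_phi q = (\<Sum>\<^sub>\<infinity>n\<in>(UNIV :: int set). q powi (n\<^sup>2))"

definition ramanujan_psi :: "'a::{real_normed_field,banach} \<Rightarrow> 'a" where
  "ramanujan_psi q = (\<Sum>n. q ^ (n * (n + 1) div 2))"

definition qpochhammer_inf :: "'a \<Rightarrow> 'a \<Rightarrow> 'a::{real_normed_field,banach}" where
  "qpochhammer_inf a q = (\<Prod>k. 1 - a * q ^ k)"

definition ramanujan_chi :: "'a::{real_normed_field,banach} \<Rightarrow> 'a" where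
  "ramanujan_chi q = qpochhammer_inf (- q) (q\<^sup>2)"

text \<open>
  The parameters below are meant to be positive rationals.  The base \<open>q\<close> is then a
  positive real, so rational powers of \<open>q\<close> are expressed by \<open>powr\<close>.
\<close>

definition class_invariant_g :: "rat \<Rightarrow> real" where
  "class_invariant_g r =
     (let q = exp (- pi * sqrt (real_of_rat r))
      in 2 powr (- 1 / 4) * q powr (- 1 / 24) * ramanujan_chi (- q))"

definition theta_product_a :: "rat \<Rightarrow> rat \<Rightarrow> real" where
  "theta_product_a m n =
     (let q = exp (- pi * sqrt (real_of_rat (m / n))); \<nu> = real_of_rat n
      in \<nu> * q powr ((\<nu> - 1) / 4)
           * (ramanujan_psi (q powr \<nu>))\<^sup>2 * (ramanujan_phi (- (q powr (2 * \<nu>))))\<^sup>2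
         / ((ramanujan_psi q)\<^sup>2 * (ramanujan_phi (- (q\<^sup>2)))\<^sup>2))"

definition theta_product_b :: "rat \<Rightarrow> rat \<Rightarrow> real" where
  "theta_product_b m n =
     (let q = exp (- pi * sqrt (real_of_rat (m / n))); \<nu> = real_of_rat n
      in \<nu> * q powr ((\<nu> - 1) / 4)
           * (ramanujan_psi (q powr \<nu>))\<^sup>2 * (ramanujan_phi (- (q powr \<nu>)))\<^sup>2
         / ((ramanujan_psi q)\<^sup>2 * (ramanujan_phi (- q))\<^sup>2))"

end

theory Submission
  imports Defs
begin

text \<open>
  Write \<open>e\<^sub>k = (q\<^sup>k; q\<^sup>k)\<^sub>\<infinity>\<close> with \<open>q\<close> the nome of \<open>a\<^bsub>m,3\<^esub>\<close>; the nomes of \<open>b\<^bsub>4m,3\<^esub>\<close> and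
  \<open>g\<^bsub>3m\<^esub>\<close> are \<open>q\<^sup>2\<close> and \<open>q\<^sup>3\<close>. By the Jacobi triple product everything becomes a quotient of
  the \<open>e\<^sub>k\<close> with \<open>k\<close> dividing 12. The 3-dissections
  \<open>\<psi>(q) = f(q\<^sup>3, q\<^sup>6) + q \<psi>(q\<^sup>9)\<close> and \<open>\<phi>(-q) = \<phi>(-q\<^sup>9) - 2q f(-q\<^sup>3, -q\<^bsup>15\<^esup>)\<close>,
  multiplied over \<open>q, \<omega>q, \<omega>\<^sup>2q\<close> for a primitive cube root of unity \<open>\<omega>\<close>, give two polynomial
  relations between \<open>e\<^sub>1, e\<^sub>2, e\<^sub>3, e\<^sub>6\<close>. With \<open>x = q e\<^sub>1\<^sup>3 e\<^sub>6\<^sup>9 / (e\<^sub>2\<^sup>3 e\<^sub>3\<^sup>9)\<close> they say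
  \<open>1 + x = e\<^sub>2\<^sup>5 e\<^sub>6 / (e\<^sub>1 e\<^sub>3\<^sup>5)\<close> and \<open>1 - 8x = e\<^sub>1\<^sup>8 e\<^sub>6\<^sup>4 / (e\<^sub>2\<^sup>4 e\<^sub>3\<^sup>8)\<close>, whence
  \<open>\<Lambda>\<^sup>2 = (1 - 8x) / (x (1 + x))\<close> and \<open>\<Lambda>ab = 9x / (1 + x)\<^sup>2\<close>; this is the second identity.
  The first one also involves \<open>e\<^sub>4\<close> and \<open>e\<^bsub>12\<^esub>\<close>, and results from eliminating
  \<open>e\<^sub>4 e\<^bsub>12\<^esub>\<close> from the same two relations at \<open>q\<^sup>2\<close>.
\<close>

section \<open>Finite triple product\<close>

lemma convergent_prod_qpochhammer:
  fixes a q :: "'a::{real_normed_field,banach}"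
  assumes "norm q < 1"
  shows "convergent_prod (\<lambda>k. 1 - a * q ^ k)"
proof -
  have "summable (\<lambda>k. norm a * norm q ^ k)"
    using assms by (intro summable_mult summable_geometric) simp
  hence "summable (\<lambda>k. norm ((1 - a * q ^ k) - 1))"
    by (simp add: norm_mult norm_power)
  thus ?thesis
    by (intro abs_convergent_prod_imp_convergent_prod summable_imp_abs_convergent_prod)
qed

lemma qpochhammer_inf_LIMSEQ:
  fixes a q :: "'a::{real_normed_field,banach}"
  assumes "norm q < 1"
  shows "(\<lambda>n. \<Prod>k<n. 1 - a * q ^ k) \<longlonglongrightarrow> qpochhammer_inf a q"
  using convergent_prod_LIMSEQ[OF convergent_prod_qpochhammer[OF assms, of a]]
  unfolding qpochhammer_inf_def lessThan_Suc_atMost[symmetric]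
  by (subst (asm) filterlim_sequentially_Suc)

lemma norm_mult_power_less_1:
  fixes a q :: "'a::real_normed_field"
  assumes "norm q < 1" "norm a < 1"
  shows "norm (a * q ^ k) < 1"
  using mult_less_le_imp_less[of "norm a" 1 "norm q ^ k" 1] assms
  by (cases "q = 0") (auto simp: norm_mult norm_power power_le_one power_0_left)

lemma qpochhammer_inf_nonzero:
  fixes a q :: "'a::{real_normed_field,banach}"
  assumes "norm q < 1" "norm a < 1"
  shows "qpochhammer_inf a q \<noteq> 0"
  unfolding qpochhammer_inf_def
proof (rule prodinf_nonzero)
  show "1 - a * q ^ k \<noteq> 0" for k
    using norm_mult_power_less_1[OF assms, of k] by auto
qed (rule convergent_prod_qpochhammer[OF assms(1)])

section \<open>Gaussian binomial coefficients\<close>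

definition qfact :: "'a::field \<Rightarrow> nat \<Rightarrow> 'a" where
  "qfact p n = (\<Prod>i<n. 1 - p * p ^ i)"

text \<open>Here \<open>qfact p n\<close> is (p; p)_n, written as a partial product of
  \<open>qpochhammer_inf p p\<close>. The value 0 for \<open>k > n\<close> lets the Pascal rules
  hold at the boundary.\<close>

definition qbinomial :: "'a::field \<Rightarrow> nat \<Rightarrow> nat \<Rightarrow> 'a" where
  "qbinomial p n k = (if k \<le> n then qfact p n / (qfact p k * qfact p (n - k)) else 0)"

lemma qfact_0 [simp]: "qfact p 0 = 1"
  and qfact_Suc: "qfact p (Suc n) = qfact p n * (1 - p ^ Suc n)"
  by (simp_all add: qfact_def)

lemma one_minus_power_nonzero:
  fixes p :: "'a::real_normed_field"
  assumes "norm p < 1"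
  shows "1 - p ^ Suc n \<noteq> 0"
  using norm_mult_power_less_1[OF assms assms, of n] by auto

lemma qfact_nonzero:
  fixes p :: "'a::real_normed_field"
  assumes "norm p < 1"
  shows "qfact p n \<noteq> 0"
  using one_minus_power_nonzero[OF assms] by (simp add: qfact_def)

lemma qbinomial_0 [simp]: "norm p < 1 \<Longrightarrow> qbinomial p n 0 = 1"
  for p :: "'a::real_normed_field"
  by (simp add: qbinomial_def qfact_nonzero)

lemma qbinomial_self [simp]: "norm p < 1 \<Longrightarrow> qbinomial p n n = 1"
  for p :: "'a::real_normed_field"
  by (simp add: qbinomial_def qfact_nonzero)

lemma qbinomial_eq_0 [simp]: "k > n \<Longrightarrow> qbinomial p n k = 0"
  by (simp add: qbinomial_def)

text \<open>For k < n, with \<open>A = p ^ Suc k\<close> and \<open>B = p ^ Suc r\<close>, the two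
  rules come down to 1 - A B = (1 - B) + B (1 - A) and 1 - A B = A (1 - B) + (1 - A). The first
  serves the induction on \<open>m\<close> in the finite triple product, the second the induction on
  \<open>n\<close>.\<close>

lemma qbinomial_pascal:
  fixes p :: "'a::real_normed_field"
  assumes p: "norm p < 1" and "k \<le> n"
  shows "qbinomial p (Suc n) (Suc k) = qbinomial p n (Suc k) + p ^ (n - k) * qbinomial p n k"
    and "qbinomial p (Suc n) (Suc k) = p ^ Suc k * qbinomial p n (Suc k) + qbinomial p n k"
proof -
  have "qbinomial p (Suc n) (Suc k) = qbinomial p n (Suc k) + p ^ (n - k) * qbinomial p n k \<and>
        qbinomial p (Suc n) (Suc k) = p ^ Suc k * qbinomial p n (Suc k) + qbinomial p n k"
  proof (cases "k = n")
    case True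
    thus ?thesis using p by simp
  next
    case False
    define r where "r = n - Suc k"
    have n: "n = Suc (k + r)"
      using False \<open>k \<le> n\<close> by (simp add: r_def)
    have [simp]: "Suc (k + r) - k = Suc r" by simp
    have nz: "1 - p ^ Suc k \<noteq> 0" "1 - p ^ Suc r \<noteq> 0" "qfact p k \<noteq> 0" "qfact p r \<noteq> 0"
      using one_minus_power_nonzero[OF p] qfact_nonzero[OF p] by blast+
    define A B where "A = p ^ Suc k" and "B = p ^ Suc r"
    have AB: "p ^ Suc (Suc (k + r)) = A * B"
      by (simp add: A_def B_def power_add)
    have 1: "qbinomial p (Suc n) (Suc k) =
        qfact p n * (1 - A * B) / (qfact p k * (1 - A) * (qfact p r * (1 - B)))"
      by (simp add: qbinomial_def n qfact_Suc[of p "Suc (k + r)"] qfact_Suc[of p k]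
          qfact_Suc[of p r] AB del: power_Suc flip: A_def B_def)
    have 2: "qbinomial p n (Suc k) = qfact p n / (qfact p k * (1 - A) * qfact p r)"
      by (simp add: qbinomial_def n qfact_Suc[of p k] del: power_Suc flip: A_def B_def)
    have 3: "qbinomial p n k = qfact p n / (qfact p k * (qfact p r * (1 - B)))"
      by (simp add: qbinomial_def n qfact_Suc[of p r] del: power_Suc flip: A_def B_def)
    have 4: "p ^ (n - k) = B" by (simp add: n B_def)
    show ?thesis
      unfolding 1 2 3 4 A_def[symmetric]
      using nz[folded A_def B_def] by (simp add: divide_simps) (simp add: algebra_simps)
  qed
  thus "qbinomial p (Suc n) (Suc k) = qbinomial p n (Suc k) + p ^ (n - k) * qbinomial p n k"
    and "qbinomial p (Suc n) (Suc k) = p ^ Suc k * qbinomial p n (Suc k) + qbinomial p n k"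
    by auto
qed

text \<open>Summed over all integers \<open>j\<close>, this is Ramanujan's general theta function \<open>f(a, b)\<close>.\<close>

definition theta_term :: "'a::field \<Rightarrow> 'a \<Rightarrow> int \<Rightarrow> 'a" where
  "theta_term a b j = a powi (j * (j + 1) div 2) * b powi (j * (j - 1) div 2)"

lemma theta_term_0 [simp]: "theta_term a b 0 = 1"
  by (simp add: theta_term_def)

text \<open>This ratio of neighbouring terms drives both the induction for the finite product and
  the ratio test.\<close>

lemma theta_term_plus_1:
  assumes "a \<noteq> 0" "b \<noteq> 0"
  shows "theta_term a b (j + 1) = a * (a * b) powi j * theta_term a b j"
proof -
  have "(j + 1) * (j + 1 + 1) = j * (j + 1) + (j + 1) * 2"
       "(j + 1) * (j + 1 - 1) = j * (j - 1) + j * 2" by algebra+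
  hence e: "(j + 1) * (j + 1 + 1) div 2 = j * (j + 1) div 2 + (j + 1)"
       "(j + 1) * (j + 1 - 1) div 2 = j * (j - 1) div 2 + j" by (metis div_mult_self1 add.commute zero_neq_numeral)+
  show ?thesis
    unfolding theta_term_def e using assms
    by (simp add: power_int_add power_int_mult_distrib algebra_simps)
qed

lemma theta_term_minus: "theta_term a b (- j) = theta_term b a j"
proof -
  have "(- j) * (- j + 1) = j * (j - 1)" "(- j) * (- j - 1) = j * (j + 1)" by algebra+
  thus ?thesis unfolding theta_term_def by (simp only: mult.commute)
qed

text \<open>Induction on \<open>n\<close> at \<open>m = 0\<close>, then on \<open>m\<close>. A new
  factor splits the sum into two copies whose indices differ by one, and a Pascal rule merges their
  coefficients.\<close>

lemma finite_triple_product: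
  fixes a b :: "'a::real_normed_field"
  assumes nz: "a \<noteq> 0" "b \<noteq> 0" and p: "norm (a * b) < 1"
  shows "(\<Prod>i<m. 1 + a * (a * b) ^ i) * (\<Prod>i<n. 1 + b * (a * b) ^ i) =
    (\<Sum>k\<le>m + n. qbinomial (a * b) (m + n) k * theta_term a b (int k - int n))"
proof (induction m)
  case 0
  show ?case
  proof (induction n)
    case (Suc n)
    let ?p = "a * b" and ?t = "theta_term a b"
    have pnz: "?p \<noteq> 0" using nz by simp
    have t: "b * ?p ^ n * ?t (int k - int n) = ?p ^ k * ?t (int k - int (Suc n))" for k
      using theta_term_plus_1[OF nz, of "int k - int (Suc n)"] pnz nz
      by (simp add: power_int_diff power_int_add field_simps)
    have "(\<Prod>i<Suc n. 1 + b * ?p ^ i) =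
        (\<Sum>k\<le>n. qbinomial ?p n k * ?t (int k - int n)) * (1 + b * ?p ^ n)"
      using Suc by simp
    also have "\<dots> = (\<Sum>k\<le>n. qbinomial ?p n k * ?t (int (Suc k) - int (Suc n))) +
        (\<Sum>k\<le>n. ?p ^ k * qbinomial ?p n k * ?t (int k - int (Suc n)))"
      unfolding distrib_left mult_1_right sum_distrib_right sum.distrib[symmetric]
      by (intro sum.cong refl) (use t in \<open>auto simp: mult_ac\<close>)
    \<comment> \<open>The added term has a vanishing coefficient. Once the term at 0 is split off,
      both sums run over the same indices \<open>Suc k\<close>.\<close>
    also have "(\<Sum>k\<le>n. ?p ^ k * qbinomial ?p n k * ?t (int k - int (Suc n))) =
        (\<Sum>k\<le>Suc n. ?p ^ k * qbinomial ?p n k * ?t (int k - int (Suc n)))"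
      by simp
    also have "\<dots> = ?t (- int (Suc n)) +
        (\<Sum>k\<le>n. ?p ^ Suc k * qbinomial ?p n (Suc k) * ?t (int (Suc k) - int (Suc n)))"
      using p by (subst sum.atMost_Suc_shift) simp
    also have "(\<Sum>k\<le>n. qbinomial ?p n k * ?t (int (Suc k) - int (Suc n))) + \<dots> =
        ?t (- int (Suc n)) +
        (\<Sum>k\<le>n. qbinomial ?p (Suc n) (Suc k) * ?t (int (Suc k) - int (Suc n)))"
      using qbinomial_pascal(2)[OF p, of _ n]
      by (simp add: sum.distrib[symmetric] algebra_simps del: of_nat_Suc power_Suc)
    also have "\<dots> = (\<Sum>k\<le>Suc n. qbinomial ?p (Suc n) k * ?t (int k - int (Suc n)))"
      using p by (subst sum.atMost_Suc_shift) simp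
    finally show ?case by simp
  qed (use p in simp)
next
  case (Suc m)
  let ?p = "a * b" and ?t = "theta_term a b" and ?N = "m + n"
  have pnz: "?p \<noteq> 0" using nz by simp
  have t: "a * ?p ^ m * ?t (int k - int n) = ?p ^ (?N - k) * ?t (int (Suc k) - int n)"
    if "k \<le> ?N" for k
  proof -
    have "?p powi int m = ?p powi int (?N - k) * ?p powi (int k - int n)"
      using that pnz by (simp add: flip: power_int_add)
    thus ?thesis
      using theta_term_plus_1[OF nz, of "int k - int n"] by (simp add: algebra_simps)
  qed
  have "(\<Prod>i<Suc m. 1 + a * ?p ^ i) * (\<Prod>i<n. 1 + b * ?p ^ i) =
      (\<Sum>k\<le>?N. qbinomial ?p ?N k * ?t (int k - int n)) * (1 + a * ?p ^ m)"
    using Suc by (simp add: mult_ac)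
  also have "\<dots> = (\<Sum>k\<le>?N. qbinomial ?p ?N k * ?t (int k - int n)) +
      (\<Sum>k\<le>?N. ?p ^ (?N - k) * qbinomial ?p ?N k * ?t (int (Suc k) - int n))"
    unfolding distrib_left mult_1_right sum_distrib_right sum.distrib[symmetric]
    by (intro sum.cong refl) (use t in \<open>auto simp: mult_ac\<close>)
  also have "(\<Sum>k\<le>?N. qbinomial ?p ?N k * ?t (int k - int n)) =
      (\<Sum>k\<le>Suc ?N. qbinomial ?p ?N k * ?t (int k - int n))"
    by simp
  also have "\<dots> = ?t (- int n) + (\<Sum>k\<le>?N. qbinomial ?p ?N (Suc k) * ?t (int (Suc k) - int n))"
    using p by (subst sum.atMost_Suc_shift) simp
  also have "\<dots> + (\<Sum>k\<le>?N. ?p ^ (?N - k) * qbinomial ?p ?N k * ?t (int (Suc k) - int n)) =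
      ?t (- int n) + (\<Sum>k\<le>?N. qbinomial ?p (Suc ?N) (Suc k) * ?t (int (Suc k) - int n))"
    using qbinomial_pascal(1)[OF p, of _ ?N]
    by (simp add: sum.distrib[symmetric] algebra_simps del: of_nat_Suc power_Suc)
  also have "\<dots> = (\<Sum>k\<le>Suc ?N. qbinomial ?p (Suc ?N) k * ?t (int k - int n))"
    using p by (subst sum.atMost_Suc_shift) simp
  finally show ?case by simp
qed

section \<open>Summability and uniform bounds for the passage to the limit\<close>

lemma summable_norm_theta_term_nat:
  fixes a b :: "'a::real_normed_field"
  assumes nz: "a \<noteq> 0" "b \<noteq> 0" and p: "norm (a * b) < 1"
  shows "summable (\<lambda>j. norm (theta_term a b (int j)))"
proof -
  \<comment> \<open>The ratio a (a b)^j of consecutive terms tends to 0 whatever the size of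
    \<open>a\<close>; 1/2 is just a convenient bound below 1.\<close>
  have "(\<lambda>j. norm (a * (a * b) ^ j)) \<longlonglongrightarrow> 0"
    using p by (intro tendsto_norm_zero tendsto_mult_right_zero LIMSEQ_power_zero)
  hence "\<forall>\<^sub>F j in sequentially. norm (a * (a * b) ^ j) < 1 / 2"
    by (rule order_tendstoD) simp
  then obtain N where N: "norm (a * (a * b) ^ j) < 1 / 2" if "j \<ge> N" for j
    by (auto simp: eventually_sequentially)
  show ?thesis
  proof (rule summable_ratio_test[of "1 / 2" N])
    fix j assume "N \<le> j"
    have "theta_term a b (int (Suc j)) = (a * (a * b) ^ j) * theta_term a b (int j)"
      using theta_term_plus_1[OF nz, of "int j"] by (simp add: algebra_simps)
    thus "norm (norm (theta_term a b (int (Suc j)))) \<le> 1 / 2 * norm (norm (theta_term a b (int j)))"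
      using mult_right_mono[OF less_imp_le[OF N[OF \<open>N \<le> j\<close>]],
          of "norm (theta_term a b (int j))"]
      by (simp add: norm_mult del: of_nat_Suc)
  qed simp
qed

lemma summable_norm_theta_term_neg:
  fixes a b :: "'a::real_normed_field"
  assumes "a \<noteq> 0" "b \<noteq> 0" "norm (a * b) < 1"
  shows "summable (\<lambda>j. norm (theta_term a b (- int (Suc j))))"
proof -
  have "summable (\<lambda>j. norm (theta_term b a (int j)))"
    using assms by (intro summable_norm_theta_term_nat) (auto simp: mult.commute)
  thus ?thesis
    unfolding theta_term_minus by (rule summable_Suc_iff[THEN iffD2])
qed

text \<open>\<open>qfact p\<close> converges to a nonzero limit, so it and its inverse are bounded.
  Uniformity in \<open>n\<close> and \<open>k\<close> supplies the majorant for Tannery's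
  theorem.\<close>

lemma qbinomial_bounded:
  fixes p :: "'a::{real_normed_field,banach}"
  assumes p: "norm p < 1"
  obtains K where "\<And>n k. norm (qbinomial p n k) \<le> K" "K \<ge> 0"
proof -
  have lim: "qfact p \<longlonglongrightarrow> qpochhammer_inf p p"
    using qpochhammer_inf_LIMSEQ[OF p, of p] by (simp add: qfact_def [abs_def])
  have "Bseq (qfact p)"
    using lim by (intro convergent_imp_Bseq convergentI)
  then obtain M where M: "norm (qfact p n) \<le> M" "M > 0" for n
    by (auto simp: Bseq_def)
  have "Bseq (\<lambda>n. inverse (qfact p n))"
    using tendsto_inverse[OF lim qpochhammer_inf_nonzero[OF p p]]
    by (intro convergent_imp_Bseq convergentI)
  then obtain L where L: "norm (inverse (qfact p n)) \<le> L" "L > 0" for n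
    by (auto simp: Bseq_def)
  show ?thesis
  proof (rule that[of "M * (L * L)"])
    show "norm (qbinomial p n k) \<le> M * (L * L)" for n k
    proof (cases "k \<le> n")
      case True
      hence "norm (qbinomial p n k) = norm (qfact p n) *
          (norm (inverse (qfact p k)) * norm (inverse (qfact p (n - k))))"
        by (simp add: qbinomial_def norm_mult norm_divide norm_inverse divide_inverse)
      also have "\<dots> \<le> M * (L * L)"
        using M L by (intro mult_mono) auto
      finally show ?thesis .
    qed (use M L in \<open>simp add: less_imp_le\<close>)
  qed (use M L in \<open>simp add: less_imp_le\<close>)
qed

section \<open>The Jacobi triple product\<close>

lemma qbinomial_symmetric: "k \<le> n \<Longrightarrow> qbinomial p n (n - k) = qbinomial p n k"
  by (simp add: qbinomial_def mult.commute)

text \<open>All three q-factorials tend to (p; p)_inf, which leaves one copy in the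
  denominator.\<close>

lemma qbinomial_central_LIMSEQ:
  fixes p :: "'a::{real_normed_field,banach}"
  assumes p: "norm p < 1"
  shows "(\<lambda>n. qbinomial p (n + n) (n + j)) \<longlonglongrightarrow> 1 / qpochhammer_inf p p"
proof -
  let ?E = "qpochhammer_inf p p"
  have nz: "?E \<noteq> 0" by (rule qpochhammer_inf_nonzero[OF p p])
  have lim: "qfact p \<longlonglongrightarrow> ?E"
    using qpochhammer_inf_LIMSEQ[OF p, of p] by (simp add: qfact_def [abs_def])
  have l1: "(\<lambda>n. qfact p (n + n)) \<longlonglongrightarrow> ?E"
    by (rule filterlim_compose[OF lim]) (rule filterlim_at_top_mono[OF filterlim_ident], simp)
  have l2: "(\<lambda>n. qfact p (n + j)) \<longlonglongrightarrow> ?E"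
    by (rule filterlim_compose[OF lim filterlim_add_const_nat_at_top])
  have l3: "(\<lambda>n. qfact p (n - j)) \<longlonglongrightarrow> ?E"
    by (rule filterlim_compose[OF lim filterlim_minus_const_nat_at_top])
  have "(\<lambda>n. qfact p (n + n) / (qfact p (n + j) * qfact p (n - j))) \<longlonglongrightarrow> ?E / (?E * ?E)"
    using nz by (intro tendsto_divide tendsto_mult l1 l2 l3) auto
  moreover have "\<forall>\<^sub>F n in sequentially.
      qfact p (n + n) / (qfact p (n + j) * qfact p (n - j)) = qbinomial p (n + n) (n + j)"
    using eventually_ge_at_top[of j] by eventually_elim (simp add: qbinomial_def)
  ultimately show ?thesis
    using nz by (simp add: tendsto_cong)
qed

text \<open>Pairing \<open>j\<close> with -(j + 1) covers every integer exactly once, 0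
  included.\<close>

lemma has_sum_int_split:
  fixes f :: "int \<Rightarrow> 'a::banach"
  assumes "summable (\<lambda>j. norm (f (int j)))" "summable (\<lambda>j. norm (f (- int (Suc j))))"
    and "(\<lambda>j. f (int j) + f (- int (Suc j))) sums S"
  shows "(f has_sum S) UNIV"
proof -
  have 1: "((\<lambda>j. f (int j)) has_sum (\<Sum>j. f (int j))) UNIV"
          "((\<lambda>j. f (- int (Suc j))) has_sum (\<Sum>j. f (- int (Suc j)))) UNIV"
    using assms by (auto intro!: norm_summable_imp_has_sum dest: summable_norm_cancel)
  have "range int = {0..}" "range (\<lambda>j. - int (Suc j)) = {..<0}"
    using zero_le_imp_eq_int negD by (auto simp: image_iff)
  moreover have "inj int" "inj (\<lambda>j. - int (Suc j))"
    by (auto simp: inj_on_def)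
  ultimately have "(f has_sum (\<Sum>j. f (int j))) {0..}"
      "(f has_sum (\<Sum>j. f (- int (Suc j)))) {..<0}"
    using 1 has_sum_reindex[of int UNIV f] has_sum_reindex[of "\<lambda>j. - int (Suc j)" UNIV f]
    by (simp_all add: o_def)
  hence "(f has_sum ((\<Sum>j. f (int j)) + (\<Sum>j. f (- int (Suc j))))) ({0..} \<union> {..<0})"
    by (rule has_sum_Un_disjoint) auto
  moreover have "(\<Sum>j. f (int j)) + (\<Sum>j. f (- int (Suc j))) = S"
    using assms by (subst suminf_add) (auto dest: summable_norm_cancel simp: sums_iff)
  moreover have "{0..} \<union> {..<0} = (UNIV :: int set)" by auto
  ultimately show ?thesis by simp
qed

text \<open>Limit of the finite product with \<open>m = n\<close>. Each binomial tends to 1 / (p;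
  p)_inf with p = a b, which accounts for the third factor; Tannery's theorem exchanges limit and
  sum.\<close>

theorem jacobi_triple_product:
  fixes a b :: "'a::{real_normed_field,banach}"
  assumes nz: "a \<noteq> 0" "b \<noteq> 0" and p: "norm (a * b) < 1"
  shows "(theta_term a b has_sum
    (qpochhammer_inf (- a) (a * b) * qpochhammer_inf (- b) (a * b) * qpochhammer_inf (a * b) (a * b)))
    UNIV"
proof (rule has_sum_int_split)
  let ?p = "a * b" and ?t = "theta_term a b"
  let ?E = "qpochhammer_inf ?p ?p"
  show s1: "summable (\<lambda>j. norm (?t (int j)))" and s2: "summable (\<lambda>j. norm (?t (- int (Suc j))))"
    using assms by (intro summable_norm_theta_term_nat summable_norm_theta_term_neg; simp)+
  obtain K where K: "norm (qbinomial ?p n k) \<le> K" "K \<ge> 0" for n k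
    using qbinomial_bounded[OF p] by blast
  \<comment> \<open>The terms of the finite identity at \<open>j\<close> and -(j + 1). By symmetry
    the coefficient at n - (j + 1) is taken at n + (j + 1), which is the form whose limit is
    known.\<close>
  define u where "u = (\<lambda>j n. qbinomial ?p (n + n) (n + j) * ?t (int j) +
      qbinomial ?p (n + n) (n + Suc j) * ?t (- int (Suc j)))"
  define v where "v = (\<lambda>j. ?t (int j) + ?t (- int (Suc j)))"
  have sum_u: "(\<Sum>j. u j n) = (\<Prod>i<n. 1 + a * ?p ^ i) * (\<Prod>i<n. 1 + b * ?p ^ i)" for n
  proof -
    let ?f = "\<lambda>k. qbinomial ?p (n + n) k * ?t (int k - int n)"
    have "(\<Sum>j. u j n) = (\<Sum>j\<le>n. u j n)"
      by (rule suminf_finite) (auto simp: u_def)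
    also have "\<dots> = (\<Sum>j\<le>n. qbinomial ?p (n + n) (n + j) * ?t (int j)) +
        (\<Sum>j\<le>n. qbinomial ?p (n + n) (n + Suc j) * ?t (- int (Suc j)))"
      unfolding u_def by (rule sum.distrib)
    also have "(\<Sum>j\<le>n. qbinomial ?p (n + n) (n + j) * ?t (int j)) = (\<Sum>k=n..n+n. ?f k)"
      by (rule sum.reindex_bij_witness[of _ "\<lambda>k. k - n" "\<lambda>j. n + j"]) auto
    \<comment> \<open>At \<open>j = n\<close> the lower index 2n + 1 exceeds 2n, so this term is
      0.\<close>
    also have "(\<Sum>j\<le>n. qbinomial ?p (n + n) (n + Suc j) * ?t (- int (Suc j))) =
        (\<Sum>j<n. qbinomial ?p (n + n) (n + Suc j) * ?t (- int (Suc j)))"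
      by (rule sum.mono_neutral_right) auto
    also have "\<dots> = (\<Sum>j<n. ?f (n - Suc j))"
    proof (intro sum.cong refl)
      fix j assume "j \<in> {..<n}"
      hence "n - Suc j = n + n - (n + Suc j)" "int (n - Suc j) - int n = - int (Suc j)"
        by auto
      thus "qbinomial ?p (n + n) (n + Suc j) * ?t (- int (Suc j)) = ?f (n - Suc j)"
        using \<open>j \<in> {..<n}\<close> by (simp only: qbinomial_symmetric)
    qed
    also have "\<dots> = (\<Sum>k<n. ?f k)"
      by (rule sum.nat_diff_reindex)
    also have "(\<Sum>k=n..n+n. ?f k) + \<dots> = (\<Sum>k\<in>{n..n+n} \<union> {..<n}. ?f k)"
      by (rule sum.union_disjoint[symmetric]) auto
    also have "{n..n+n} \<union> {..<n} = {..n+n}" by auto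
    finally show ?thesis
      using finite_triple_product[OF nz p, of n n] by simp
  qed
  have u_lim: "u j \<longlonglongrightarrow> v j / ?E" for j
    using tendsto_add[OF tendsto_mult_right[OF qbinomial_central_LIMSEQ[OF p], of j "?t (int j)"]
        tendsto_mult_right[OF qbinomial_central_LIMSEQ[OF p], of "Suc j" "?t (- int (Suc j))"]]
    by (simp add: u_def v_def add_divide_distrib)
  define M where "M = (\<lambda>j. K * (norm (?t (int j)) + norm (?t (- int (Suc j)))))"
  have M: "norm (u j n) \<le> M j" for j n
    unfolding u_def M_def distrib_left
    by (intro order.trans[OF norm_triangle_ineq] add_mono)
       (auto simp: norm_mult intro!: mult_right_mono K)
  have "summable M"
    unfolding M_def by (intro summable_mult summable_add s1 s2)
  hence lim: "summable (\<lambda>j. norm (v j / ?E))" "(\<lambda>n. \<Sum>j. u j n) \<longlonglongrightarrow> (\<Sum>j. v j / ?E)"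
    using tannerys_theorem[of u "\<lambda>j. v j / ?E" sequentially M, OF u_lim] M
    by (auto simp: case_prod_unfold)
  have "(\<lambda>n. \<Sum>j. u j n) \<longlonglongrightarrow> qpochhammer_inf (- a) ?p * qpochhammer_inf (- b) ?p"
    unfolding sum_u using qpochhammer_inf_LIMSEQ[OF p, of "- a"] qpochhammer_inf_LIMSEQ[OF p, of "- b"]
    by (intro tendsto_mult) simp_all
  with lim(2) have "(\<Sum>j. v j / ?E) = qpochhammer_inf (- a) ?p * qpochhammer_inf (- b) ?p"
    using LIMSEQ_unique by blast
  hence "(\<lambda>j. v j / ?E) sums (qpochhammer_inf (- a) ?p * qpochhammer_inf (- b) ?p)"
    using summable_sums[OF summable_norm_cancel[OF lim(1)]] by simp
  hence "(\<lambda>j. v j / ?E * ?E) sums (qpochhammer_inf (- a) ?p * qpochhammer_inf (- b) ?p * ?E)"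
    by (rule sums_mult2)
  thus "(\<lambda>j. ?t (int j) + ?t (- int (Suc j))) sums
      (qpochhammer_inf (- a) ?p * qpochhammer_inf (- b) ?p * ?E)"
    using qpochhammer_inf_nonzero[OF p p] by (simp add: v_def)
qed

section \<open>Theta functions as products\<close>

text \<open>The factors are sorted by the residue of the exponent mod \<open>k\<close>, in partial
  products of length \<open>n * k\<close>.\<close>

lemma qpochhammer_inf_split:
  fixes a q :: "'a::{real_normed_field,banach}"
  assumes q: "norm q < 1" and k: "k > 0"
  shows "qpochhammer_inf a q = (\<Prod>i<k. qpochhammer_inf (a * q ^ i) (q ^ k))"
proof (rule LIMSEQ_unique)
  have "filterlim (\<lambda>n. n * k) sequentially sequentially"
    using k by (intro filterlim_at_top_mono[OF filterlim_ident]) simp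
  from filterlim_compose[OF qpochhammer_inf_LIMSEQ[OF q, of a] this]
  show "(\<lambda>n. \<Prod>j<n * k. 1 - a * q ^ j) \<longlonglongrightarrow> qpochhammer_inf a q" .
  have qk: "norm (q ^ k) < 1"
    using q k by (simp add: norm_power power_less_one_iff)
  have "(\<Prod>j<n * k. 1 - a * q ^ j) = (\<Prod>i<k. \<Prod>m<n. 1 - a * q ^ i * (q ^ k) ^ m)" for n
  proof -
    have "(\<Prod>j<n * k. 1 - a * q ^ j) = (\<Prod>m<n. \<Prod>j=m*k..<m*k+k. 1 - a * q ^ j)"
      by (rule prod.nat_group[symmetric])
    also have "\<dots> = (\<Prod>m<n. \<Prod>i<k. 1 - a * q ^ i * (q ^ k) ^ m)"
    proof (rule prod.cong[OF refl])
      fix m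
      show "(\<Prod>j=m*k..<m*k+k. 1 - a * q ^ j) = (\<Prod>i<k. 1 - a * q ^ i * (q ^ k) ^ m)"
        by (rule prod.reindex_bij_witness[of _ "\<lambda>i. m * k + i" "\<lambda>j. j - m * k"])
           (auto simp: mult.assoc mult.commute simp flip: power_mult power_add)
    qed
    also have "\<dots> = (\<Prod>i<k. \<Prod>m<n. 1 - a * q ^ i * (q ^ k) ^ m)"
      by (rule prod.swap)
    finally show ?thesis .
  qed
  moreover have "(\<lambda>n. \<Prod>i<k. \<Prod>m<n. 1 - a * q ^ i * (q ^ k) ^ m) \<longlonglongrightarrow>
      (\<Prod>i<k. qpochhammer_inf (a * q ^ i) (q ^ k))"
    by (intro tendsto_prod qpochhammer_inf_LIMSEQ[OF qk])
  ultimately show "(\<lambda>n. \<Prod>j<n * k. 1 - a * q ^ j) \<longlonglongrightarrow>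
      (\<Prod>i<k. qpochhammer_inf (a * q ^ i) (q ^ k))"
    by simp
qed

lemma qpochhammer_inf_mult_minus:
  fixes a q :: "'a::{real_normed_field,banach}"
  assumes q: "norm q < 1"
  shows "qpochhammer_inf a q * qpochhammer_inf (- a) q = qpochhammer_inf (a\<^sup>2) (q\<^sup>2)"
proof (rule LIMSEQ_unique)
  have "norm (q\<^sup>2) < 1"
    using q by (simp add: norm_power power_less_one_iff)
  thus "(\<lambda>n. \<Prod>k<n. 1 - a\<^sup>2 * (q\<^sup>2) ^ k) \<longlonglongrightarrow> qpochhammer_inf (a\<^sup>2) (q\<^sup>2)"
    by (rule qpochhammer_inf_LIMSEQ)
  have "(1 - a * q ^ k) * (1 - (- a) * q ^ k) = 1 - a\<^sup>2 * (q\<^sup>2) ^ k" for k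
    by (simp add: power_mult [symmetric] mult.commute[of k] algebra_simps power2_eq_square
        power_mult_distrib)
  thus "(\<lambda>n. \<Prod>k<n. 1 - a\<^sup>2 * (q\<^sup>2) ^ k) \<longlonglongrightarrow> qpochhammer_inf a q * qpochhammer_inf (- a) q"
    using tendsto_mult[OF qpochhammer_inf_LIMSEQ[OF q, of a] qpochhammer_inf_LIMSEQ[OF q, of "- a"]]
    by (simp flip: prod.distrib)
qed

lemma qpochhammer_inf_head:
  fixes a q :: "'a::{real_normed_field,banach}"
  assumes q: "norm q < 1"
  shows "qpochhammer_inf a q = (1 - a) * qpochhammer_inf (a * q) q"
proof (rule LIMSEQ_unique)
  show "(\<lambda>n. \<Prod>k<Suc n. 1 - a * q ^ k) \<longlonglongrightarrow> qpochhammer_inf a q"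
    using qpochhammer_inf_LIMSEQ[OF q] by (rule LIMSEQ_Suc)
  show "(\<lambda>n. \<Prod>k<Suc n. 1 - a * q ^ k) \<longlonglongrightarrow> (1 - a) * qpochhammer_inf (a * q) q"
    unfolding prod.lessThan_Suc_shift
    using tendsto_mult_left[OF qpochhammer_inf_LIMSEQ[OF q, of "a * q"], of "1 - a"]
    by (simp add: mult.assoc)
qed

text \<open>Euler's product (q; q)_inf, the Dedekind eta function without its factor
  q^(1/24).\<close>

definition euler_product :: "'a::{real_normed_field,banach} \<Rightarrow> 'a" where
  "euler_product q = qpochhammer_inf q q"

lemma euler_product_nonzero: "norm q < 1 \<Longrightarrow> euler_product q \<noteq> 0"
  unfolding euler_product_def by (rule qpochhammer_inf_nonzero)

lemma norm_power_less_1: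
  fixes q :: "'a::real_normed_field"
  shows "norm q < 1 \<Longrightarrow> k > 0 \<Longrightarrow> norm (q ^ k) < 1"
  by (simp add: norm_power power_less_one_iff)

lemma qpochhammer_inf_odd:
  fixes q :: "'a::{real_normed_field,banach}"
  assumes q: "norm q < 1"
  shows "qpochhammer_inf q (q\<^sup>2) = euler_product q / euler_product (q\<^sup>2)"
  using qpochhammer_inf_split[OF q, of 2 q] euler_product_nonzero[OF norm_power_less_1[OF q, of 2]]
  by (simp add: euler_product_def numeral_2_eq_2 field_simps)

lemma qpochhammer_inf_minus_self:
  fixes q :: "'a::{real_normed_field,banach}"
  assumes q: "norm q < 1"
  shows "qpochhammer_inf (- q) q = euler_product (q\<^sup>2) / euler_product q"
  using qpochhammer_inf_mult_minus[OF q, of q] euler_product_nonzero[OF q]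
  by (simp add: euler_product_def field_simps)

lemma has_sum_theta_phi:
  fixes q :: "'a::{real_normed_field,banach}"
  assumes "norm q < 1" "q \<noteq> 0"
  shows "(theta_term (- q) (- q) has_sum (euler_product q)\<^sup>2 / euler_product (q\<^sup>2)) UNIV"
proof -
  have "norm (- q * - q) < 1"
    using norm_power_less_1[OF assms(1), of 2] by (simp add: power2_eq_square)
  from jacobi_triple_product[OF _ _ this] assms
  have "(theta_term (- q) (- q) has_sum
      (qpochhammer_inf q (q\<^sup>2) * qpochhammer_inf q (q\<^sup>2) * euler_product (q\<^sup>2))) UNIV"
    by (simp add: power2_eq_square[of q] euler_product_def)
  thus ?thesis
    using euler_product_nonzero[OF norm_power_less_1[OF assms(1), of 2]]
    by (simp add: qpochhammer_inf_odd[OF assms(1)] power2_eq_square[of "euler_product q"])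
qed

text \<open>The bilateral series is 2 psi(q), since every triangular exponent occurs twice. On the
  product side the 2 is the head factor of \<open>qpochhammer_inf (- 1) q\<close>.\<close>

lemma has_sum_theta_psi:
  fixes q :: "'a::{real_normed_field,banach}"
  assumes "norm q < 1" "q \<noteq> 0"
  shows "(theta_term 1 q has_sum 2 * (euler_product (q\<^sup>2))\<^sup>2 / euler_product q) UNIV"
proof -
  have "(theta_term 1 q has_sum
      (qpochhammer_inf (- 1) q * qpochhammer_inf (- q) q * euler_product q)) UNIV"
    using jacobi_triple_product[of 1 q] assms by (simp add: euler_product_def)
  moreover have "qpochhammer_inf (- 1) q = 2 * qpochhammer_inf (- q) q"
    using qpochhammer_inf_head[OF assms(1), of "- 1"] by simp
  ultimately show ?thesis
    using euler_product_nonzero[OF assms(1)]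
    by (simp add: qpochhammer_inf_minus_self[OF assms(1)] power2_eq_square mult.assoc)
qed

lemma prod_lessThan_3: "(\<Prod>i<3. f i) = f 0 * f 1 * f (2::nat)"
  by (simp add: numeral_3_eq_3 numeral_2_eq_2)

text \<open>Splitting (-q; q)_inf mod 3 gives the two factors of the triple product and (-q^3;
  q^3)_inf, which is divided out.\<close>

lemma has_sum_theta_1_2:
  fixes q :: "'a::{real_normed_field,banach}"
  assumes "norm q < 1" "q \<noteq> 0"
  shows "(theta_term q (q ^ 2) has_sum
    euler_product (q ^ 2) * (euler_product (q ^ 3))\<^sup>2 / (euler_product q * euler_product (q ^ 6))) UNIV"
proof -
  note nz = euler_product_nonzero[OF norm_power_less_1[OF assms(1)]] euler_product_nonzero[OF assms(1)]
  have p: "q * q ^ 2 = q ^ 3" "(q ^ 3)\<^sup>2 = q ^ 6"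
    by (simp_all flip: power_Suc power_mult)
  have "(theta_term q (q ^ 2) has_sum
      (qpochhammer_inf (- q) (q ^ 3) * qpochhammer_inf (- (q ^ 2)) (q ^ 3) * euler_product (q ^ 3))) UNIV"
    using jacobi_triple_product[of q "q ^ 2"] assms norm_power_less_1[OF assms(1), of 3]
    unfolding p by (simp add: euler_product_def)
  moreover have "qpochhammer_inf (- q) q =
      qpochhammer_inf (- q) (q ^ 3) * qpochhammer_inf (- (q ^ 2)) (q ^ 3) *
      qpochhammer_inf (- (q ^ 3)) (q ^ 3)"
    using qpochhammer_inf_split[OF assms(1), of 3 "- q"]
    by (simp add: numeral_3_eq_3 power2_eq_square)
  hence "qpochhammer_inf (- q) (q ^ 3) * qpochhammer_inf (- (q ^ 2)) (q ^ 3) =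
      (euler_product (q ^ 2) / euler_product q) / (euler_product (q ^ 6) / euler_product (q ^ 3))"
    using qpochhammer_inf_minus_self[OF assms(1)] nz
      qpochhammer_inf_minus_self[OF norm_power_less_1[OF assms(1), of 3]]
    by (simp add: p(2) field_simps)
  ultimately show ?thesis
    by (simp add: power2_eq_square mult_ac)
qed

text \<open>Splitting (q; q^2)_inf mod 3 gives the exponents 1, 3, 5 mod 6; the middle class (q^3;
  q^6)_inf is divided out.\<close>

lemma has_sum_theta_1_5:
  fixes q :: "'a::{real_normed_field,banach}"
  assumes "norm q < 1" "q \<noteq> 0"
  shows "(theta_term (- q) (- (q ^ 5)) has_sum
    euler_product q * (euler_product (q ^ 6))\<^sup>2 / (euler_product (q ^ 2) * euler_product (q ^ 3))) UNIV"
proof -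
  note nz = euler_product_nonzero[OF norm_power_less_1[OF assms(1)]] euler_product_nonzero[OF assms(1)]
  have p: "- q * - (q ^ 5) = q ^ 6" "(q ^ 3)\<^sup>2 = q ^ 6" "(q ^ 2) ^ 3 = q ^ 6" "q * (q ^ 2)\<^sup>2 = q ^ 5"
      "q * q ^ 2 = q ^ 3"
    by (simp_all flip: power_Suc power_mult)
  have "(theta_term (- q) (- (q ^ 5)) has_sum
      (qpochhammer_inf q (q ^ 6) * qpochhammer_inf (q ^ 5) (q ^ 6) * euler_product (q ^ 6))) UNIV"
    using jacobi_triple_product[of "- q" "- (q ^ 5)"] assms norm_power_less_1[OF assms(1), of 6]
    unfolding p by (simp add: euler_product_def)
  moreover have "qpochhammer_inf q (q ^ 2) =
      qpochhammer_inf q (q ^ 6) * qpochhammer_inf (q ^ 3) (q ^ 6) * qpochhammer_inf (q ^ 5) (q ^ 6)"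
    using qpochhammer_inf_split[OF norm_power_less_1[OF assms(1), of 2], of 3 q]
    unfolding prod_lessThan_3 p by (simp add: p)
  hence "qpochhammer_inf q (q ^ 6) * qpochhammer_inf (q ^ 5) (q ^ 6) =
      (euler_product q / euler_product (q ^ 2)) / (euler_product (q ^ 3) / euler_product (q ^ 6))"
    using qpochhammer_inf_odd[OF assms(1)] nz
      qpochhammer_inf_odd[OF norm_power_less_1[OF assms(1), of 3]]
    by (simp add: p(2) field_simps)
  ultimately show ?thesis
    by (simp add: power2_eq_square mult_ac)
qed

section \<open>3-dissections\<close>

text \<open>Only the one integer division j (j - 1) / 2 remains, so a single substitution settles
  all exponents in the dissections.\<close>

lemma theta_term_eq:
  "theta_term a b j = a powi (j * (j - 1) div 2 + j) * b powi (j * (j - 1) div 2)"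
proof -
  have "j * (j + 1) = j * (j - 1) + j * 2" by algebra
  hence "j * (j + 1) div 2 = j * (j - 1) div 2 + j"
    by (metis add.commute div_mult_self1 zero_neq_numeral)
  thus ?thesis by (simp add: theta_term_def)
qed

lemma theta_term_power:
  assumes "x \<noteq> 0"
  shows "theta_term (x ^ m) (x ^ n) j =
    x powi (int m * (j * (j - 1) div 2 + j) + int n * (j * (j - 1) div 2))"
  using assms by (simp add: theta_term_eq power_int_add power_int_mult)

lemma has_sum_int_mod_3:
  fixes f :: "int \<Rightarrow> 'a::banach"
  assumes "((\<lambda>k. f (3 * k)) has_sum x) UNIV" "((\<lambda>k. f (3 * k + 1)) has_sum y) UNIV"
    and "((\<lambda>k. f (3 * k - 1)) has_sum z) UNIV"
  shows "(f has_sum (x + y + z)) UNIV"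
proof -
  have "(f has_sum x) (range (\<lambda>k. 3 * k))" "(f has_sum y) (range (\<lambda>k. 3 * k + 1))"
      "(f has_sum z) (range (\<lambda>k. 3 * k - 1))"
    using assms by (subst has_sum_reindex; simp add: inj_on_def o_def)+
  moreover have "range (\<lambda>k. 3 * k) \<inter> range (\<lambda>k::int. 3 * k + 1) = {}"
      "(range (\<lambda>k. 3 * k) \<union> range (\<lambda>k. 3 * k + 1)) \<inter> range (\<lambda>k::int. 3 * k - 1) = {}"
    by (auto, presburger+)
  ultimately have "(f has_sum (x + y + z))
      ((range (\<lambda>k. 3 * k) \<union> range (\<lambda>k. 3 * k + 1)) \<union> range (\<lambda>k. 3 * k - 1))"
    by (intro has_sum_Un_disjoint)
  moreover have "(range (\<lambda>k. 3 * k) \<union> range (\<lambda>k. 3 * k + 1)) \<union> range (\<lambda>k. 3 * k - 1) = (UNIV :: int set)"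
  proof -
    have "j \<in> range (\<lambda>k. 3 * k) \<or> j \<in> range (\<lambda>k. 3 * k + 1) \<or> j \<in> range (\<lambda>k::int. 3 * k - 1)" for j
      unfolding image_iff by simp presburger
    thus ?thesis by blast
  qed
  ultimately show ?thesis by simp
qed

lemma has_sum_theta_term_swap:
  "(theta_term a b has_sum s) UNIV \<Longrightarrow> (theta_term b a has_sum s) UNIV"
  by (subst has_sum_reindex_bij_witness[of UNIV uminus uminus UNIV "theta_term a b"])
     (simp_all add: theta_term_minus)

lemma triangular_obtain: obtains t :: int where "j * (j - 1) = 2 * t" "j * (j - 1) div 2 = t"
proof -
  have "even (j * (j - 1))" by simp
  then obtain t where "j * (j - 1) = 2 * t" by (elim dvdE)
  with that show ?thesis by simp
qed

text \<open>The classes 3k and 3k + 1 give f(q^3, q^6) and its mirror image, with equal sums; 3k - 1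
  gives q f(1, q^9). Both psi series appear doubled: \<open>v\<close> stands for 2 psi(q^9).\<close>

lemma theta_psi_dissection:
  fixes q :: "'a::{real_normed_field,banach}"
  assumes q: "norm q < 1" "q \<noteq> 0"
    and "(theta_term (q ^ 3) (q ^ 6) has_sum u) UNIV" "(theta_term 1 (q ^ 9) has_sum v) UNIV"
  shows "(theta_term 1 q has_sum (2 * u + q * v)) UNIV"
proof -
  have e: "theta_term 1 q (3 * k) = theta_term (q ^ 3) (q ^ 6) k \<and>
      theta_term 1 q (3 * k + 1) = theta_term (q ^ 6) (q ^ 3) k \<and>
      theta_term 1 q (3 * k - 1) = q * theta_term 1 (q ^ 9) k" for k
  proof -
    obtain t where t: "k * (k - 1) = 2 * t" "k * (k - 1) div 2 = t"
      by (rule triangular_obtain)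
    have "(3 * k) * (3 * k - 1) = 2 * (9 * t + 3 * k)"
         "(3 * k + 1) * (3 * k + 1 - 1) = 2 * (9 * t + 6 * k)"
         "(3 * k - 1) * (3 * k - 1 - 1) = 2 * (9 * t + 1)"
      using t(1) by (simp_all add: algebra_simps)
    hence *: "(3 * k) * (3 * k - 1) div 2 = 9 * t + 3 * k"
         "(3 * k + 1) * (3 * k + 1 - 1) div 2 = 9 * t + 6 * k"
         "(3 * k - 1) * (3 * k - 1 - 1) div 2 = 9 * t + 1"
      by simp_all
    show ?thesis
      using theta_term_power[OF q(2), of 0 1] theta_term_power[OF q(2), of 3 6]
        theta_term_power[OF q(2), of 6 3] theta_term_power[OF q(2), of 0 9]
      by (simp only: * t(2) power_0 power_one_right)
         (use q(2) in \<open>simp add: power_int_add algebra_simps\<close>)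
  qed
  have "(theta_term 1 q has_sum (u + u + q * v)) UNIV"
    by (rule has_sum_int_mod_3)
       (simp_all add: e assms has_sum_theta_term_swap has_sum_cmult_right)
  thus ?thesis by simp
qed

text \<open>Here the classes 3k + 1 and 3k - 1 are the mirror images, both contributing -q f(-q^3,
  -q^15).\<close>

lemma theta_phi_dissection:
  fixes q :: "'a::{real_normed_field,banach}"
  assumes q: "norm q < 1" "q \<noteq> 0"
    and "(theta_term (- (q ^ 9)) (- (q ^ 9)) has_sum u) UNIV"
    and "(theta_term (- (q ^ 3)) (- (q ^ 15)) has_sum v) UNIV"
  shows "(theta_term (- q) (- q) has_sum (u - 2 * q * v)) UNIV"
proof -
  \<comment> \<open>The powers 1, 3, 9, 15 are odd, so this substitution absorbs all signs.\<close>
  define x where "x = - q"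
  have x: "x \<noteq> 0" "- (q ^ 9) = x ^ 9" "- (q ^ 3) = x ^ 3" "- (q ^ 15) = x ^ 15"
    using q by (simp_all add: x_def)
  have e: "theta_term x x (3 * k) = theta_term (x ^ 9) (x ^ 9) k \<and>
      theta_term x x (3 * k + 1) = x * theta_term (x ^ 15) (x ^ 3) k \<and>
      theta_term x x (3 * k - 1) = x * theta_term (x ^ 3) (x ^ 15) k" for k
  proof -
    obtain t where t: "k * (k - 1) = 2 * t" "k * (k - 1) div 2 = t"
      by (rule triangular_obtain)
    have "(3 * k) * (3 * k - 1) = 2 * (9 * t + 3 * k)"
         "(3 * k + 1) * (3 * k + 1 - 1) = 2 * (9 * t + 6 * k)"
         "(3 * k - 1) * (3 * k - 1 - 1) = 2 * (9 * t + 1)"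
      using t(1) by (simp_all add: algebra_simps)
    hence *: "(3 * k) * (3 * k - 1) div 2 = 9 * t + 3 * k"
         "(3 * k + 1) * (3 * k + 1 - 1) div 2 = 9 * t + 6 * k"
         "(3 * k - 1) * (3 * k - 1 - 1) div 2 = 9 * t + 1"
      by simp_all
    have x1: "x * x powi n = x powi (n + 1)" for n
      using x(1) by (simp add: power_int_add)
    show ?thesis
      using theta_term_power[OF x(1), of 1 1] theta_term_power[OF x(1), of 3 15]
        theta_term_power[OF x(1), of 15 3] theta_term_power[OF x(1), of 9 9]
      by (simp only: * t(2) power_one_right x1) (simp add: algebra_simps)
  qed
  have "(theta_term x x has_sum (u + x * v + x * v)) UNIV"
    by (rule has_sum_int_mod_3)
       (use assms in \<open>simp_all add: e x has_sum_theta_term_swap has_sum_cmult_right\<close>)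
  thus ?thesis by (simp add: x_def mult.assoc)
qed

section \<open>Relations of level 6\<close>

lemma primitive_cube_root:
  fixes w :: "'a::real_normed_field"
  assumes "w\<^sup>2 + w + 1 = 0"
  shows "w ^ 3 = 1" "norm w = 1"
proof -
  show "w ^ 3 = 1" using assms by algebra
  hence "norm w ^ 3 = 1"
    by (metis norm_power norm_one)
  thus "norm w = 1"
    by (metis norm_ge_zero power_eq_1_iff zero_neq_numeral real_norm_def abs_of_nonneg)
qed

text \<open>Since (1 - y) (1 - w y) (1 - w^2 y) = 1 - y^3, exponents prime to 3 give (q^3; q^3)_inf
  without its factors from (q^9; q^9)_inf. Exponents divisible by 3 occur three times and give (q^3;
  q^3)_inf cubed.\<close>

lemma euler_product_cube_roots:
  fixes q w :: "'a::{real_normed_field,banach}"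
  assumes q: "norm q < 1" and w: "w\<^sup>2 + w + 1 = 0"
  shows "euler_product q * euler_product (w * q) * euler_product (w\<^sup>2 * q) * euler_product (q ^ 9) =
    euler_product (q ^ 3) ^ 4"
proof -
  note w3 = primitive_cube_root(1)[OF w] and nw = primitive_cube_root(2)[OF w]
  have lim: "(\<lambda>n. qfact x n) \<longlonglongrightarrow> euler_product x" if "norm x < 1" for x :: 'a
    using qpochhammer_inf_LIMSEQ[OF that, of x] by (simp add: qfact_def euler_product_def)
  have lim3: "(\<lambda>n. qfact x (3 * n)) \<longlonglongrightarrow> euler_product x" if "norm x < 1" for x :: 'a
    by (rule filterlim_compose[OF lim[OF that]])
       (rule filterlim_at_top_mono[OF filterlim_ident], simp)
  \<comment> \<open>Truncation at 3n, and at n for q^9, makes the identity exact at finite level;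
    each step adds the exponents 3n + 1, 3n + 2, 3n + 3.\<close>
  have fin: "qfact q (3 * n) * qfact (w * q) (3 * n) * qfact (w\<^sup>2 * q) (3 * n) * qfact (q ^ 9) n =
      qfact (q ^ 3) (3 * n) * qfact (q ^ 3) n ^ 3" for n
  proof (induction n)
    case (Suc n)
    have split: "(1 - y) * (1 - w * y) * (1 - w\<^sup>2 * y) = 1 - y ^ 3" for y
      using w by algebra
    define z where "z = q ^ (3 * n)"
    have s: "3 * Suc n = Suc (Suc (Suc (3 * n)))" by simp
    have p1: "qfact x (3 * Suc n) = qfact x (3 * n) * (1 - x * x ^ (3 * n)) *
        (1 - x ^ 2 * x ^ (3 * n)) * (1 - x ^ 3 * x ^ (3 * n))" for x :: 'a
      unfolding s qfact_Suc by (simp add: power2_eq_square power3_eq_cube mult.assoc)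
    have p2: "qfact (q ^ 3) (Suc n) = qfact (q ^ 3) n * (1 - q ^ 3 * z)"
        "qfact (q ^ 9) (Suc n) = qfact (q ^ 9) n * (1 - (q ^ 3 * z) ^ 3)"
      by (simp_all add: qfact_Suc z_def power_mult_distrib flip: power_mult add: mult.commute)
    have p3: "(q ^ 3) ^ (3 * n) = z ^ 3" by (simp add: z_def mult.commute flip: power_mult)
    have w4: "(w * q)\<^sup>2 = w\<^sup>2 * q\<^sup>2" "(w\<^sup>2 * q)\<^sup>2 = w * q\<^sup>2" "(w * q) ^ 3 = q ^ 3" "(w\<^sup>2 * q) ^ 3 = q ^ 3"
      using w3 power_mult[of w 3 2] power_add[of w 3 1]
      by (simp_all add: power_mult_distrib flip: power_mult)
    have pw: "(w * q) ^ (3 * n) = z" "(w\<^sup>2 * q) ^ (3 * n) = z"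
      by (simp_all only: z_def power_mult w4)
    have "qfact q (3 * Suc n) * qfact (w * q) (3 * Suc n) * qfact (w\<^sup>2 * q) (3 * Suc n) * qfact (q ^ 9) (Suc n) =
        (qfact q (3 * n) * qfact (w * q) (3 * n) * qfact (w\<^sup>2 * q) (3 * n) * qfact (q ^ 9) n) *
        ((1 - q * z) * (1 - w * (q * z)) * (1 - w\<^sup>2 * (q * z))) *
        ((1 - q\<^sup>2 * z) * (1 - w * (q\<^sup>2 * z)) * (1 - w\<^sup>2 * (q\<^sup>2 * z))) *
        (1 - q ^ 3 * z) ^ 3 * (1 - (q ^ 3 * z) ^ 3)"
      unfolding p1[of q] p1[of "w * q"] p1[of "w\<^sup>2 * q"] p2 pw w4 z_def[symmetric]
      by (simp add: power3_eq_cube mult_ac)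
    also have "\<dots> = qfact (q ^ 3) (3 * Suc n) * qfact (q ^ 3) (Suc n) ^ 3"
      unfolding Suc.IH split p1[of "q ^ 3"] p2(1) p3 power_mult_distrib
      by (simp add: mult_ac flip: power_mult)
    finally show ?case .
  qed simp
  have n: "norm (w * q) < 1" "norm (w\<^sup>2 * q) < 1" "norm (q ^ 9) < 1" "norm (q ^ 3) < 1"
    using q by (simp_all add: norm_mult norm_power nw power_less_one_iff)
  have "(\<lambda>n. qfact (q ^ 3) (3 * n) * qfact (q ^ 3) n ^ 3) \<longlonglongrightarrow>
      euler_product q * euler_product (w * q) * euler_product (w\<^sup>2 * q) * euler_product (q ^ 9)"
    unfolding fin[symmetric] by (intro tendsto_mult lim lim3 n q)
  moreover have "(\<lambda>n. qfact (q ^ 3) (3 * n) * qfact (q ^ 3) n ^ 3) \<longlonglongrightarrow>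
      euler_product (q ^ 3) * euler_product (q ^ 3) ^ 3"
    by (intro tendsto_mult tendsto_power lim lim3 n)
  ultimately have "euler_product q * euler_product (w * q) * euler_product (w\<^sup>2 * q) * euler_product (q ^ 9) =
      euler_product (q ^ 3) * euler_product (q ^ 3) ^ 3"
    by (rule LIMSEQ_unique)
  thus ?thesis by (simp flip: power_Suc)
qed

text \<open>
  Both cubic identities come from multiplying the 3-dissection of a theta function over
  \<open>q\<close>, \<open>\<omega>q\<close>, \<open>\<omega>\<^sup>2q\<close>.
\<close>

lemma euler_product_level_6_cubed:
  fixes q w :: "'a::{real_normed_field,banach}"
  assumes q: "norm q < 1" "q \<noteq> 0" and w: "w\<^sup>2 + w + 1 = 0"
  defines "e \<equiv> \<lambda>k. euler_product (q ^ k)"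
  shows "e 6 ^ 8 * e 9 ^ 4 * e 18 = e 3 * e 6 ^ 3 * e 9 ^ 9 + q ^ 3 * e 3 ^ 4 * e 18 ^ 9"
    and "e 6 ^ 4 * e 9 ^ 9 = e 3 ^ 8 * e 18 ^ 4 * e 9 + 8 * q ^ 3 * e 3 ^ 3 * e 6 * e 18 ^ 9"
proof -
  note w3 = primitive_cube_root(1)[OF w] and nw = primitive_cube_root(2)[OF w]
  have w0: "w \<noteq> 0" using nw by auto
  \<comment> \<open>\<open>P x\<close> is psi(x) and \<open>F x\<close> is phi(-x); \<open>A\<close>
    is f(q^3, q^6) and \<open>B\<close> is f(-q^3, -q^15), all as quotients of Euler
    products.\<close>
  define P where "P = (\<lambda>x::'a. (euler_product (x\<^sup>2))\<^sup>2 / euler_product x)"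
  define F where "F = (\<lambda>x::'a. (euler_product x)\<^sup>2 / euler_product (x\<^sup>2))"
  define A where "A = e 6 * e 9 ^ 2 / (e 3 * e 18)"
  define B where "B = e 3 * e 18 ^ 2 / (e 6 * e 9)"
  have nz: "e k \<noteq> 0" if "k > 0" for k
    unfolding e_def using that q by (intro euler_product_nonzero norm_power_less_1)
  \<comment> \<open>The coefficients depend on \<open>x\<close> only through x^3, so the same ones
    serve q, w q and w^2 q.\<close>
  have split: "P x = A + x * (e 18 ^ 2 / e 9) \<and> F x = e 9 ^ 2 / e 18 + x * (- 2 * B)"
    if x: "norm x < 1" "x \<noteq> 0" "x ^ 3 = q ^ 3" for x
  proof -
    have pw: "x ^ 9 = q ^ 9" "x ^ 6 = q ^ 6" "x ^ 15 = q ^ 15"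
      using power_mult[of x 3 3] power_mult[of q 3 3] power_mult[of x 3 2] power_mult[of q 3 2]
        power_mult[of x 3 5] power_mult[of q 3 5] x(3) by simp_all
    have x': "norm (q ^ 3) < 1" "norm (q ^ 9) < 1" "q ^ 3 \<noteq> 0" "q ^ 9 \<noteq> 0"
      using q norm_power_less_1[OF q(1)] by simp_all
    have t: "(theta_term (x ^ 3) (x ^ 6) has_sum A) UNIV"
      "(theta_term 1 (x ^ 9) has_sum (2 * (e 18 ^ 2 / e 9))) UNIV"
      "(theta_term (- (x ^ 9)) (- (x ^ 9)) has_sum e 9 ^ 2 / e 18) UNIV"
      "(theta_term (- (x ^ 3)) (- (x ^ 15)) has_sum B) UNIV"
      using has_sum_theta_1_2[OF x'(1,3)] has_sum_theta_psi[OF x'(2,4)]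
        has_sum_theta_phi[OF x'(2,4)] has_sum_theta_1_5[OF x'(1,3)]
      by (simp_all add: A_def B_def e_def pw x(3) flip: power_mult)
    have "(theta_term 1 x has_sum (2 * P x)) UNIV" "(theta_term (- x) (- x) has_sum F x) UNIV"
      using has_sum_theta_psi[OF x(1,2)] has_sum_theta_phi[OF x(1,2)] by (simp_all add: P_def F_def)
    hence "2 * P x = 2 * A + x * (2 * (e 18 ^ 2 / e 9))" "F x = e 9 ^ 2 / e 18 - 2 * x * B"
      using theta_psi_dissection[OF x(1,2) t(1,2)] theta_phi_dissection[OF x(1,2) t(3,4)]
      by (simp_all add: has_sum_unique)
    moreover have "2 * A + x * (2 * (e 18 ^ 2 / e 9)) = 2 * (A + x * (e 18 ^ 2 / e 9))"
      by (simp add: algebra_simps)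
    ultimately have "2 * P x = 2 * (A + x * (e 18 ^ 2 / e 9))" "F x = e 9 ^ 2 / e 18 - 2 * x * B"
      by (simp_all only:)
    moreover have "e 9 ^ 2 / e 18 - 2 * x * B = e 9 ^ 2 / e 18 + x * (- 2 * B)"
      by simp
    ultimately show ?thesis by (simp only: mult_left_cancel zero_neq_numeral[symmetric] simp_thms not_False_eq_True)
  qed
  have nq: "norm (w * q) < 1" "norm (w\<^sup>2 * q) < 1" "w * q \<noteq> 0" "w\<^sup>2 * q \<noteq> 0"
      "(w * q) ^ 3 = q ^ 3" "(w\<^sup>2 * q) ^ 3 = q ^ 3"
    using q w0 w3 power_mult[of w 3 2]
    by (simp_all add: norm_mult norm_power nw power_mult_distrib flip: power_mult)
  have E1: "euler_product q * euler_product (w * q) * euler_product (w\<^sup>2 * q) = e 3 ^ 4 / e 9"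
    using euler_product_cube_roots[OF q(1) w] nz[of 9] by (simp add: e_def field_simps)
  have ww: "(w * q)\<^sup>2 = w\<^sup>2 * q\<^sup>2" "(w\<^sup>2 * q)\<^sup>2 = w * q\<^sup>2"
    using w3 power_add[of w 3 1] by (simp_all add: power_mult_distrib flip: power_mult)
  have E2: "euler_product (q\<^sup>2) * euler_product ((w * q)\<^sup>2) * euler_product ((w\<^sup>2 * q)\<^sup>2) = e 6 ^ 4 / e 18"
    using euler_product_cube_roots[OF norm_power_less_1[OF q(1), of 2] w] nz[of 18]
    unfolding ww by (simp add: e_def field_simps flip: power_mult)
  have PP: "P q * P (w * q) * P (w\<^sup>2 * q) = (e 6 ^ 4 / e 18)\<^sup>2 / (e 3 ^ 4 / e 9)"
    unfolding E1[symmetric] E2[symmetric] P_def by (simp add: power_mult_distrib)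
  have FF: "F q * F (w * q) * F (w\<^sup>2 * q) = (e 3 ^ 4 / e 9)\<^sup>2 / (e 6 ^ 4 / e 18)"
    unfolding E1[symmetric] E2[symmetric] F_def by (simp add: power_mult_distrib)
  have norm3: "(u + q * v) * (u + w * q * v) * (u + w\<^sup>2 * q * v) = u ^ 3 + q ^ 3 * v ^ 3" for u v
    using w by algebra
  have "P q * P (w * q) * P (w\<^sup>2 * q) = A ^ 3 + q ^ 3 * (e 18 ^ 2 / e 9) ^ 3"
    by (simp only: split[OF q refl] split[OF nq(1,3,5)] split[OF nq(2,4,6)] norm3)
  hence "(e 6 ^ 4 / e 18)\<^sup>2 / (e 3 ^ 4 / e 9) =
      (e 6 * e 9 ^ 2 / (e 3 * e 18)) ^ 3 + q ^ 3 * (e 18 ^ 2 / e 9) ^ 3"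
    unfolding PP A_def .
  thus "e 6 ^ 8 * e 9 ^ 4 * e 18 = e 3 * e 6 ^ 3 * e 9 ^ 9 + q ^ 3 * e 3 ^ 4 * e 18 ^ 9"
    using nz[of 3] nz[of 6] nz[of 9] nz[of 18] by (simp add: divide_simps) algebra
  have "F q * F (w * q) * F (w\<^sup>2 * q) = (e 9 ^ 2 / e 18) ^ 3 + q ^ 3 * (- 2 * B) ^ 3"
    by (simp only: split[OF q refl] split[OF nq(1,3,5)] split[OF nq(2,4,6)] norm3)
  hence "(e 3 ^ 4 / e 9)\<^sup>2 / (e 6 ^ 4 / e 18) =
      (e 9 ^ 2 / e 18) ^ 3 + q ^ 3 * (- 2 * (e 3 * e 18 ^ 2 / (e 6 * e 9))) ^ 3"
    unfolding FF B_def .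
  thus "e 6 ^ 4 * e 9 ^ 9 = e 3 ^ 8 * e 18 ^ 4 * e 9 + 8 * q ^ 3 * e 3 ^ 3 * e 6 * e 18 ^ 9"
    using nz[of 3] nz[of 6] nz[of 9] nz[of 18] by (simp add: divide_simps) algebra
qed

lemma euler_product_of_real:
  assumes "norm x < 1"
  shows "euler_product (complex_of_real x) = of_real (euler_product x)"
proof (rule LIMSEQ_unique)
  show "(\<lambda>n. \<Prod>k<n. 1 - complex_of_real x * of_real x ^ k) \<longlonglongrightarrow> euler_product (of_real x)"
    unfolding euler_product_def using assms by (intro qpochhammer_inf_LIMSEQ) simp
  show "(\<lambda>n. \<Prod>k<n. 1 - complex_of_real x * of_real x ^ k) \<longlonglongrightarrow> of_real (euler_product x)"
  proof -
    have "(\<lambda>n. complex_of_real (\<Prod>k<n. 1 - x * x ^ k)) \<longlonglongrightarrow> of_real (qpochhammer_inf x x)"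
      by (intro tendsto_of_real qpochhammer_inf_LIMSEQ assms)
    thus ?thesis by (simp add: euler_product_def)
  qed
qed

text \<open>The cubed identities depend on q^3 only and are read at the real cube root of
  \<open>q\<close>. Complex numbers enter through the root of unity \<open>w\<close>; the outcome
  relates real numbers and descends.\<close>

lemma euler_product_level_6:
  fixes q :: real
  assumes q: "0 < q" "q < 1"
  defines "e \<equiv> \<lambda>k. euler_product (q ^ k)"
  shows "e 2 ^ 8 * e 3 ^ 4 * e 6 = e 1 * e 2 ^ 3 * e 3 ^ 9 + q * e 1 ^ 4 * e 6 ^ 9"
    and "e 2 ^ 4 * e 3 ^ 9 = e 1 ^ 8 * e 6 ^ 4 * e 3 + 8 * q * e 1 ^ 3 * e 2 * e 6 ^ 9"
proof -
  define r where "r = complex_of_real (root 3 q)"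
  define w where "w = Complex (- 1 / 2) (sqrt 3 / 2)"
  have w: "w\<^sup>2 + w + 1 = 0"
    by (simp add: w_def complex_eq_iff power2_eq_square)
  have r: "norm r < 1" "r \<noteq> 0"
    using q by (simp_all add: r_def)
  have r3: "r ^ (3 * k) = of_real (q ^ k)" for k
    using q by (simp add: r_def power_mult flip: of_real_power)
  have e: "euler_product (r ^ (3 * k)) = of_real (e k)" if "k > 0" for k
    unfolding r3 e_def using that q
    by (intro euler_product_of_real) (simp add: power_less_one_iff)
  note e' = e[of 1] e[of 2] e[of 3] e[of 6] r3[of 1]
  have "complex_of_real (e 2 ^ 8 * e 3 ^ 4 * e 6) =
      of_real (e 1 * e 2 ^ 3 * e 3 ^ 9 + q * e 1 ^ 4 * e 6 ^ 9)"
    using euler_product_level_6_cubed(1)[OF r w] e' by simp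
  thus "e 2 ^ 8 * e 3 ^ 4 * e 6 = e 1 * e 2 ^ 3 * e 3 ^ 9 + q * e 1 ^ 4 * e 6 ^ 9"
    by (simp only: of_real_eq_iff)
  have "complex_of_real (e 2 ^ 4 * e 3 ^ 9) =
      of_real (e 1 ^ 8 * e 6 ^ 4 * e 3 + 8 * q * e 1 ^ 3 * e 2 * e 6 ^ 9)"
    using euler_product_level_6_cubed(2)[OF r w] e' by simp
  thus "e 2 ^ 4 * e 3 ^ 9 = e 1 ^ 8 * e 6 ^ 4 * e 3 + 8 * q * e 1 ^ 3 * e 2 * e 6 ^ 9"
    by (simp only: of_real_eq_iff)
qed

section \<open>Ramanujan's functions as products\<close>

lemma ramanujan_phi_minus:
  fixes q :: "'a::{real_normed_field,banach}"
  assumes "norm q < 1" "q \<noteq> 0"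
  shows "ramanujan_phi (- q) = (euler_product q)\<^sup>2 / euler_product (q\<^sup>2)"
proof -
  have "theta_term (- q) (- q) n = (- q) powi (n\<^sup>2)" for n
  proof -
    obtain t where t: "n * (n - 1) = 2 * t" "n * (n - 1) div 2 = t"
      by (rule triangular_obtain)
    have n: "n\<^sup>2 = (t + n) + t"
      using t(1) by (simp add: power2_eq_square algebra_simps)
    show ?thesis
      unfolding theta_term_eq t(2) n using assms by (intro power_int_add[symmetric]) simp
  qed
  hence "theta_term (- q) (- q) = (\<lambda>n. (- q) powi (n\<^sup>2))" ..
  thus ?thesis
    using infsumI[OF has_sum_theta_phi[OF assms]] by (simp add: ramanujan_phi_def)
qed

text \<open>The exponent n (n + 1) / 2 occurs in \<open>theta_term 1 q\<close> at -n and at n + 1,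
  so the bilateral sum is twice the series.\<close>

lemma ramanujan_psi_eq:
  fixes q :: "'a::{real_normed_field,banach}"
  assumes "norm q < 1" "q \<noteq> 0"
  shows "ramanujan_psi q = (euler_product (q\<^sup>2))\<^sup>2 / euler_product q"
proof -
  let ?f = "\<lambda>n. q ^ (n * (n + 1) div 2)"
  have 1: "theta_term 1 q (- int n) = ?f n" "theta_term 1 q (int (Suc n)) = ?f n" for n
  proof -
    have "- int n * (- int n - 1) = int (n * (n + 1))" "int (Suc n) * (int (Suc n) - 1) = int (n * (n + 1))"
      by (simp_all add: algebra_simps)
    hence "- int n * (- int n - 1) div 2 = int (n * (n + 1) div 2)"
        "int (Suc n) * (int (Suc n) - 1) div 2 = int (n * (n + 1) div 2)"
      by (simp_all only: zdiv_int of_nat_numeral)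
    thus "theta_term 1 q (- int n) = ?f n" "theta_term 1 q (int (Suc n)) = ?f n"
      by (simp_all only: theta_term_eq power_int_of_nat power_int_1_left mult_1)
  qed
  \<comment> \<open>After the swap equal terms sit at n and -(n + 1), the pairing used by
    \<open>has_sum_int_split\<close>.\<close>
  have 2: "theta_term q 1 (int n) = ?f n" "theta_term q 1 (- int (Suc n)) = ?f n" for n
    using 1[of n] by (simp_all only: theta_term_minus)
  have "summable (\<lambda>j. norm (theta_term q 1 (int j)))"
    using assms by (intro summable_norm_theta_term_nat) auto
  hence "summable (\<lambda>n. norm (?f n))"
    by (simp only: 2)
  hence "?f sums ramanujan_psi q"
    unfolding ramanujan_psi_def by (rule summable_sums[OF summable_norm_cancel])
  hence "(\<lambda>n. ?f n + ?f n) sums (ramanujan_psi q + ramanujan_psi q)"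
    by (intro sums_add)
  hence "(theta_term q 1 has_sum (ramanujan_psi q + ramanujan_psi q)) UNIV"
    using \<open>summable (\<lambda>n. norm (?f n))\<close>
    by (intro has_sum_int_split) (simp_all only: 2)
  hence "2 * ramanujan_psi q = 2 * ((euler_product (q\<^sup>2))\<^sup>2 / euler_product q)"
    using has_sum_theta_term_swap[OF has_sum_theta_psi[OF assms]] has_sum_unique by fastforce
  thus ?thesis by (simp only: mult_left_cancel zero_neq_numeral[symmetric] simp_thms not_False_eq_True)
qed

lemma ramanujan_chi_minus:
  fixes q :: "'a::{real_normed_field,banach}"
  assumes "norm q < 1"
  shows "ramanujan_chi (- q) = euler_product q / euler_product (q\<^sup>2)"
  using qpochhammer_inf_odd[OF assms] by (simp add: ramanujan_chi_def)

lemma euler_product_pos: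
  fixes q :: real
  assumes "0 < q" "q < 1"
  shows "euler_product q > 0"
  unfolding euler_product_def qpochhammer_inf_def
proof (rule less_0_prodinf)
  show "1 - q * q ^ i > 0" for i
    using norm_mult_power_less_1[of q q i] assms by simp
qed (use assms in \<open>simp add: convergent_prod_qpochhammer\<close>)

section \<open>Relations of level 12\<close>

text \<open>The inequality holds factor by factor: with x = q^(i + 1), removing (1 - x) (1 - x^4)
  leaves 1 + x^4 + x^8 <= 1 + x + x^2.\<close>

lemma euler_product_1_12_le_3_4:
  fixes q :: real
  assumes q: "0 < q" "q < 1"
  shows "euler_product q * euler_product (q ^ 12) \<le> euler_product (q ^ 3) * euler_product (q ^ 4)"
proof (rule LIMSEQ_le)
  have lim: "qfact (q ^ k) \<longlonglongrightarrow> euler_product (q ^ k)" if "k > 0" for k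
    using qpochhammer_inf_LIMSEQ[of "q ^ k" "q ^ k"] norm_power_less_1[of q k] that q
    by (simp add: qfact_def [abs_def] euler_product_def)
  show "(\<lambda>n. qfact q n * qfact (q ^ 12) n) \<longlonglongrightarrow> euler_product q * euler_product (q ^ 12)"
    using tendsto_mult[OF lim[of 1] lim[of 12]] by simp
  show "(\<lambda>n. qfact (q ^ 3) n * qfact (q ^ 4) n) \<longlonglongrightarrow> euler_product (q ^ 3) * euler_product (q ^ 4)"
    by (intro tendsto_mult lim) simp_all
  have "qfact q n * qfact (q ^ 12) n \<le> qfact (q ^ 3) n * qfact (q ^ 4) n" for n
    unfolding qfact_def prod.distrib[symmetric]
  proof (rule prod_mono)
    fix i assume "i \<in> {..<n}"
    define x where "x = q ^ Suc i"
    have x: "0 < x" "x < 1"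
      using q power_Suc_less_one[of q i] by (simp_all add: x_def)
    have y: "q * q ^ i = x" "q ^ k * (q ^ k) ^ i = x ^ k" for k
      by (simp_all add: x_def power_mult_distrib mult.commute flip: power_mult)
    have "0 \<le> (1 - x) * (1 - x ^ 12)"
      using x power_le_one[of x 12] by (intro mult_nonneg_nonneg) auto
    moreover have "(1 - x) * (1 - x ^ 12) = ((1 - x) * (1 - x ^ 4)) * (1 + x ^ 4 + x ^ 8)"
      by algebra
    moreover have "(1 - x ^ 3) * (1 - x ^ 4) = ((1 - x) * (1 - x ^ 4)) * (1 + x ^ 1 + x ^ 2)"
      by algebra
    moreover have "((1 - x) * (1 - x ^ 4)) * (1 + x ^ 4 + x ^ 8) \<le> ((1 - x) * (1 - x ^ 4)) * (1 + x ^ 1 + x ^ 2)"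
      using x power_le_one[of x 4] power_decreasing[of 1 4 x] power_decreasing[of 2 8 x]
      by (intro mult_left_mono add_mono mult_nonneg_nonneg) auto
    ultimately show "0 \<le> (1 - q * q ^ i) * (1 - q ^ 12 * (q ^ 12) ^ i) \<and>
        (1 - q * q ^ i) * (1 - q ^ 12 * (q ^ 12) ^ i) \<le> (1 - q ^ 3 * (q ^ 3) ^ i) * (1 - q ^ 4 * (q ^ 4) ^ i)"
      unfolding y by linarith
  qed
  thus "\<exists>N. \<forall>n\<ge>N. qfact q n * qfact (q ^ 12) n \<le> qfact (q ^ 3) n * qfact (q ^ 4) n" by blast
qed

text \<open>
  The relations at level 6 for \<open>q\<close> and \<open>q\<^sup>2\<close> force \<open>e4\<^sup>4 / e12\<^sup>4\<close>
  to satisfy a cubic equation over the level 6 functions; the cubic has the root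
  \<open>q e1\<^sup>4 / e3\<^sup>4\<close>, which is excluded by
  \<open>e1 e12 \<le> e3 e4\<close>.
\<close>

lemma level_12_quadratic:
  fixes q e1 e2 e3 e4 e6 e12 :: real
  assumes pos: "q > 0" "q < 1" "e1 > 0" "e6 > 0" "e12 > 0"
    and le: "e1 * e12 \<le> e3 * e4"
    and r1: "e2 ^ 8 * e3 ^ 4 * e6 = e1 * e2 ^ 3 * e3 ^ 9 + q * e1 ^ 4 * e6 ^ 9"
    and r2: "e2 ^ 4 * e3 ^ 9 = e1 ^ 8 * e6 ^ 4 * e3 + 8 * q * e1 ^ 3 * e2 * e6 ^ 9"
    and r3: "e4 ^ 8 * e6 ^ 4 * e12 = e2 * e4 ^ 3 * e6 ^ 9 + q\<^sup>2 * e2 ^ 4 * e12 ^ 9"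
    and r4: "e4 ^ 4 * e6 ^ 9 = e2 ^ 8 * e12 ^ 4 * e6 + 8 * q\<^sup>2 * e2 ^ 3 * e4 * e12 ^ 9"
  shows "e1 ^ 4 * e6 ^ 12 * e4 ^ 8 = e1 ^ 5 * e2 ^ 3 * e3 ^ 5 * e6 ^ 3 * e4 ^ 4 * e12 ^ 4 +
    q * e2 ^ 12 * e3 ^ 4 * e12 ^ 8"
proof -
  \<comment> \<open>Multiply \<open>r1\<close> by \<open>e2\<close> and substitute \<open>r2\<close>
    for e2^4 e3^9; the coefficient 9 is 8 + 1.\<close>
  have r5: "e2 ^ 9 * e3 ^ 4 = e1 ^ 9 * e3 * e6 ^ 3 + 9 * q * e1 ^ 4 * e2 * e6 ^ 8"
  proof -
    have "(e2 ^ 9 * e3 ^ 4) * e6 = (e1 ^ 9 * e3 * e6 ^ 3 + 9 * q * e1 ^ 4 * e2 * e6 ^ 8) * e6"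
      using r1 r2 by algebra
    thus ?thesis using pos by simp
  qed
  \<comment> \<open>Isolate e2 e4^3 e6^9 in \<open>r3\<close> and 8 q^2 e2^3 e4 e12^9 in
    \<open>r4\<close>, then multiply. Up to the common factor e12 e6, only powers of e4^4 and e12^4
    survive.\<close>
  have "(e4 ^ 8 * e6 ^ 4 - q\<^sup>2 * e2 ^ 4 * e12 ^ 8) * (e4 ^ 4 * e6 ^ 8 - e2 ^ 8 * e12 ^ 4) * (e12 * e6) =
      (8 * q\<^sup>2 * e2 ^ 4 * e6 ^ 8 * e4 ^ 4 * e12 ^ 8) * (e12 * e6)"
    using r3 r4 by algebra
  hence cubic: "(e4 ^ 8 * e6 ^ 4 - q\<^sup>2 * e2 ^ 4 * e12 ^ 8) * (e4 ^ 4 * e6 ^ 8 - e2 ^ 8 * e12 ^ 4) =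
      8 * q\<^sup>2 * e2 ^ 4 * e6 ^ 8 * e4 ^ 4 * e12 ^ 8"
    using pos by simp
  define u v where "u = e4 ^ 4" and "v = e12 ^ 4"
  have uv: "e4 ^ 8 = u\<^sup>2" "e12 ^ 8 = v\<^sup>2"
    by (simp_all add: u_def v_def flip: power_mult)
  \<comment> \<open>The linear factor of the cubic that belongs to the root q e1^4 / e3^4 of u / v.
    Multiplied by the wanted quadratic, it gives the cubic with middle coefficients that
    \<open>r1\<close> and \<open>r5\<close> simplify.\<close>
  let ?L = "u * e3 ^ 4 - q * e1 ^ 4 * v"
  have "(e1 ^ 4 * e6 ^ 12 * u\<^sup>2 - e1 ^ 5 * e2 ^ 3 * e3 ^ 5 * e6 ^ 3 * u * v - q * e2 ^ 12 * e3 ^ 4 * v\<^sup>2) * ?L =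
      e1 ^ 4 * e3 ^ 4 * e6 ^ 12 * u ^ 3 - e1 ^ 4 * e6 ^ 3 * (e1 * e2 ^ 3 * e3 ^ 9 + q * e1 ^ 4 * e6 ^ 9) * u\<^sup>2 * v
      - q * e2 ^ 3 * e3 ^ 4 * (e2 ^ 9 * e3 ^ 4 - e1 ^ 9 * e3 * e6 ^ 3) * u * v\<^sup>2 + q\<^sup>2 * e1 ^ 4 * e2 ^ 12 * e3 ^ 4 * v ^ 3"
    by algebra
  also have "\<dots> = e1 ^ 4 * e3 ^ 4 * ((u\<^sup>2 * e6 ^ 4 - q\<^sup>2 * e2 ^ 4 * v\<^sup>2) * (u * e6 ^ 8 - e2 ^ 8 * v) -
      8 * q\<^sup>2 * e2 ^ 4 * e6 ^ 8 * u * v\<^sup>2)"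
    unfolding r1[symmetric] r5 by algebra
  also have "\<dots> = 0"
    using cubic unfolding uv u_def[symmetric] v_def[symmetric] by simp
  finally have prod: "(e1 ^ 4 * e6 ^ 12 * u\<^sup>2 - e1 ^ 5 * e2 ^ 3 * e3 ^ 5 * e6 ^ 3 * u * v - q * e2 ^ 12 * e3 ^ 4 * v\<^sup>2) * ?L = 0" .
  \<comment> \<open>Strictness comes from \<open>q < 1\<close>; hence the linear factor is positive
    and cancels.\<close>
  have "q * e1 ^ 4 * v < u * e3 ^ 4"
  proof -
    have "(e1 * e12) ^ 4 \<le> (e3 * e4) ^ 4"
      using pos le by (intro power_mono) auto
    moreover have "q * (e1 * e12) ^ 4 < 1 * (e1 * e12) ^ 4"
      using pos by (intro mult_strict_right_mono) auto
    ultimately have "q * (e1 * e12) ^ 4 < (e3 * e4) ^ 4" by simp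
    thus ?thesis by (simp add: u_def v_def power_mult_distrib mult_ac)
  qed
  with prod show ?thesis
    unfolding uv u_def[symmetric] v_def[symmetric] by simp
qed

section \<open>Deduction of the two identities\<close>

lemma level_6_degree_4:
  fixes s e1 e2 e3 e6 :: real
  assumes pos: "s > 0" "e1 > 0" "e2 > 0" "e3 > 0" "e6 > 0"
    and r1: "e2 ^ 8 * e3 ^ 4 * e6 = e1 * e2 ^ 3 * e3 ^ 9 + s\<^sup>2 * e1 ^ 4 * e6 ^ 9"
    and r2: "e2 ^ 4 * e3 ^ 9 = e1 ^ 8 * e6 ^ 4 * e3 + 8 * s\<^sup>2 * e1 ^ 3 * e2 * e6 ^ 9"
  defines "L \<equiv> e1 ^ 3 * e3 ^ 3 / (s * e2 ^ 3 * e6 ^ 3)"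
    and "c \<equiv> 9 * s ^ 3 * e1\<^sup>2 * e6 ^ 10 / (e2 ^ 10 * e3\<^sup>2)"
  shows "1 / c - c = 1 / 9 * ((L ^ 4 + 11 * L\<^sup>2 - 8) / L)"
proof -
  define x where "x = s\<^sup>2 * e1 ^ 3 * e6 ^ 9 / (e2 ^ 3 * e3 ^ 9)"
  have x: "x > 0" using pos by (simp add: x_def)
  have x1: "1 + x = e2 ^ 5 * e6 / (e1 * e3 ^ 5)"
    unfolding x_def using pos by (simp add: divide_simps) (use r1 in algebra)
  have "1 - 8 * x = e1 ^ 8 * e6 ^ 4 / (e2 ^ 4 * e3 ^ 8)"
    unfolding x_def using pos by (simp add: divide_simps) (use r2 in algebra)
  hence L2: "L\<^sup>2 = (1 - 8 * x) / (x * (1 + x))"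
    unfolding x1 unfolding x_def L_def using pos by (simp add: divide_simps) algebra
  have Lc: "L * c = 9 * x / (1 + x)\<^sup>2"
    unfolding x1 unfolding x_def L_def c_def using pos by (simp add: divide_simps) algebra
  have L: "L > 0" "c > 0" using pos by (simp_all add: L_def c_def)
  \<comment> \<open>\<open>L\<close> and \<open>c\<close> are odd in \<open>s\<close> whereas
    \<open>x\<close> is even. Multiplying by \<open>L\<close> leaves only L^2 and L c, which are
    rational in \<open>x\<close>.\<close>
  have "L * (1 / c - c) = L\<^sup>2 / (L * c) - L * c"
    using L by (simp add: field_simps power2_eq_square)
  also have "\<dots> = 1 / 9 * ((L\<^sup>2)\<^sup>2 + 11 * L\<^sup>2 - 8)"
    unfolding L2 Lc using x by (simp add: divide_simps add_pos_pos) algebra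
  also have "(L\<^sup>2)\<^sup>2 = L ^ 4" by (simp flip: power_mult)
  finally show ?thesis using L by (simp add: field_simps)
qed

theorem theorem4p1:
  fixes m :: rat and \<Lambda> :: real
  assumes "m > 0"
    and "\<Lambda> = (sqrt 2 * class_invariant_g (3 * m) * class_invariant_g (m / 3)) ^ 3"
  shows "theta_product_a m 3 / theta_product_b (4 * m) 3
           - theta_product_b (4 * m) 3 / theta_product_a m 3 = \<Lambda>
       \<and> 1 / (theta_product_a m 3 * theta_product_b (4 * m) 3)
           - theta_product_a m 3 * theta_product_b (4 * m) 3
         = 1 / 9 * ((\<Lambda> ^ 4 + 11 * \<Lambda>\<^sup>2 - 8) / \<Lambda>)"
proof -
  define t where "t = sqrt (real_of_rat (m / 3))"
  define q where "q = exp (- pi * t)"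
  \<comment> \<open>This is the factor q^((n - 1)/4) of a_{m,n} at n = 3.\<close>
  define s where "s = sqrt q"
  define e where "e = (\<lambda>k. euler_product (q ^ k))"
  have "t > 0" using assms(1) by (simp add: t_def)
  hence q: "0 < q" "q < 1" by (simp_all add: q_def)
  hence s: "s > 0" "s\<^sup>2 = q" by (simp_all add: s_def)
  have t2: "sqrt (real_of_rat (4 * m / 3)) = 2 * t"
  proof -
    have "real_of_rat (4 * m / 3) = 2\<^sup>2 * real_of_rat (m / 3)"
      by (simp add: of_rat_mult of_rat_divide)
    thus ?thesis by (simp only: t_def real_sqrt_mult real_sqrt_abs abs_numeral)
  qed
  have t3: "sqrt (real_of_rat (3 * m)) = 3 * t"
  proof -
    have "real_of_rat (3 * m) = 3\<^sup>2 * real_of_rat (m / 3)"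
      by (simp add: of_rat_mult of_rat_divide)
    thus ?thesis by (simp only: t_def real_sqrt_mult real_sqrt_abs abs_numeral)
  qed
  have exps: "exp (- (pi * t)) = q" "exp (- (pi * (2 * t))) = q\<^sup>2" "exp (- (pi * (3 * t))) = q ^ 3"
    unfolding q_def by (simp_all add: mult_ac flip: exp_of_nat_mult)
  have qk: "0 < q ^ k" "q ^ k < 1" if "k > 0" for k
    using q that by (simp_all add: power_less_one_iff)
  have pos: "e k > 0" if "k > 0" for k
    unfolding e_def using qk[OF that] by (rule euler_product_pos)
  note pos' = pos[of 1] pos[of 2] pos[of 3] pos[of 4] pos[of 6] pos[of 12]
  have psi: "ramanujan_psi (q ^ k) = (e (2 * k))\<^sup>2 / e k"
    and phi: "ramanujan_phi (- (q ^ k)) = (e k)\<^sup>2 / e (2 * k)"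
    and chi: "ramanujan_chi (- (q ^ k)) = e k / e (2 * k)" if "k > 0" for k
  proof -
    have k: "norm (q ^ k) < 1" "q ^ k \<noteq> 0"
      using qk[OF that] q by auto
    show "ramanujan_psi (q ^ k) = (e (2 * k))\<^sup>2 / e k"
      "ramanujan_phi (- (q ^ k)) = (e k)\<^sup>2 / e (2 * k)"
      "ramanujan_chi (- (q ^ k)) = e k / e (2 * k)"
      unfolding e_def mult.commute[of 2] power_mult
      by (rule ramanujan_psi_eq[OF k] ramanujan_phi_minus[OF k] ramanujan_chi_minus[OF k(1)])+
  qed
  have powr_q: "(q ^ k) powr 3 = q ^ (3 * k)" "(q ^ k) powr (2 * 3) = q ^ (6 * k)" for k
    using q by (simp_all add: powr_numeral mult.commute flip: power_mult)
  have a: "theta_product_a m 3 = 3 * s * e 1 ^ 2 * e 4 ^ 2 * e 6 ^ 8 / (e 2 ^ 8 * e 3 ^ 2 * e 12 ^ 2)"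
  proof -
    have "theta_product_a m 3 = 3 * s * (ramanujan_psi (q ^ 3))\<^sup>2 * (ramanujan_phi (- (q ^ 6)))\<^sup>2 /
        ((ramanujan_psi (q ^ 1))\<^sup>2 * (ramanujan_phi (- (q ^ 2)))\<^sup>2)"
      using powr_q[of 1] q
      by (simp add: theta_product_a_def Let_def s_def powr_half_sqrt exps flip: t_def)
    also have "\<dots> = 3 * s * e 1 ^ 2 * e 4 ^ 2 * e 6 ^ 8 / (e 2 ^ 8 * e 3 ^ 2 * e 12 ^ 2)"
      using pos' by (simp add: psi[of 3] psi[of 1, simplified] phi[of 6] phi[of 2] divide_simps)
    finally show ?thesis .
  qed
  have b: "theta_product_b (4 * m) 3 = 3 * q * e 6 ^ 2 * e 12 ^ 2 / (e 2 ^ 2 * e 4 ^ 2)"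
  proof -
    have "theta_product_b (4 * m) 3 = 3 * q * (ramanujan_psi (q ^ 6))\<^sup>2 * (ramanujan_phi (- (q ^ 6)))\<^sup>2 /
        ((ramanujan_psi (q ^ 2))\<^sup>2 * (ramanujan_phi (- (q ^ 2)))\<^sup>2)"
      using powr_q(1)[of 2] q
      by (simp add: theta_product_b_def Let_def t2 exps powr_half_sqrt[of "q\<^sup>2"] del: of_rat_mult)
    also have "\<dots> = 3 * q * e 6 ^ 2 * e 12 ^ 2 / (e 2 ^ 2 * e 4 ^ 2)"
      using pos' by (simp add: psi[of 6] psi[of 2] phi[of 6] phi[of 2] divide_simps) algebra
    finally show ?thesis .
  qed
  have L: "\<Lambda> = e 1 ^ 3 * e 3 ^ 3 / (s * e 2 ^ 3 * e 6 ^ 3)"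
  proof -
    have g: "class_invariant_g (3 * m) = 2 powr (- 1 / 4) * q powr (- 1 / 8) * (e 3 / e 6)"
            "class_invariant_g (m / 3) = 2 powr (- 1 / 4) * q powr (- 1 / 24) * (e 1 / e 2)"
      using q chi[of 1] chi[of 3]
      by (simp_all add: class_invariant_g_def Let_def t3 exps powr_powr flip: t_def powr_numeral)
    have "sqrt 2 * (2 powr (- 1 / 4) * 2 powr (- 1 / 4)) = 1"
      by (simp flip: powr_half_sqrt powr_add)
    \<comment> \<open>The power q^(-1/8) is (q^3)^(-1/24), and 3 (1/8 + 1/24) = 1/2.\<close>
    moreover have "(q powr (- 1 / 8) * q powr (- 1 / 24)) ^ 3 = 1 / s"
      using q by (simp add: s_def powr_power flip: powr_half_sqrt powr_add powr_minus_divide)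
    moreover have "\<Lambda> = (sqrt 2 * (2 powr (- 1 / 4) * 2 powr (- 1 / 4))) ^ 3 *
        (q powr (- 1 / 8) * q powr (- 1 / 24)) ^ 3 * (e 1 * e 3 / (e 2 * e 6)) ^ 3"
      unfolding assms(2) g power_mult_distrib[symmetric] by (simp add: mult_ac)
    ultimately show ?thesis
      by (simp add: power_mult_distrib power_divide)
  qed

  have r: "e 2 ^ 8 * e 3 ^ 4 * e 6 = e 1 * e 2 ^ 3 * e 3 ^ 9 + q * e 1 ^ 4 * e 6 ^ 9"
      "e 2 ^ 4 * e 3 ^ 9 = e 1 ^ 8 * e 6 ^ 4 * e 3 + 8 * q * e 1 ^ 3 * e 2 * e 6 ^ 9"
    using euler_product_level_6[OF q] by (simp_all add: e_def)
  have r': "e 4 ^ 8 * e 6 ^ 4 * e 12 = e 2 * e 4 ^ 3 * e 6 ^ 9 + q\<^sup>2 * e 2 ^ 4 * e 12 ^ 9"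
      "e 4 ^ 4 * e 6 ^ 9 = e 2 ^ 8 * e 12 ^ 4 * e 6 + 8 * q\<^sup>2 * e 2 ^ 3 * e 4 * e 12 ^ 9"
    using euler_product_level_6[OF qk[of 2]] by (simp_all add: e_def flip: power_mult)
  have "e 1 ^ 4 * e 6 ^ 12 * e 4 ^ 8 = e 1 ^ 5 * e 2 ^ 3 * e 3 ^ 5 * e 6 ^ 3 * e 4 ^ 4 * e 12 ^ 4 +
      q * e 2 ^ 12 * e 3 ^ 4 * e 12 ^ 8"
    using euler_product_1_12_le_3_4[OF q] r r' pos' q
    by (intro level_12_quadratic) (simp_all add: e_def)
  \<comment> \<open>Here a / b = e1^2 e6^6 e4^4 / (s e2^6 e3^2 e12^4), so clearing denominators
    turns the claim into the quadratic relation just obtained.\<close>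
  hence "theta_product_a m 3 / theta_product_b (4 * m) 3
      - theta_product_b (4 * m) 3 / theta_product_a m 3 = \<Lambda>"
    unfolding a b L s(2)[symmetric] using pos' s(1) by (simp add: divide_simps) algebra
  \<comment> \<open>In the product a b the factors e4 and e12 cancel, which leaves a statement of
    level 6.\<close>
  moreover have ab: "theta_product_a m 3 * theta_product_b (4 * m) 3 =
      9 * s ^ 3 * (e 1)\<^sup>2 * e 6 ^ 10 / (e 2 ^ 10 * (e 3)\<^sup>2)"
    unfolding a b s(2)[symmetric] using pos' s(1) by (simp add: divide_simps) algebra
  have "1 / (theta_product_a m 3 * theta_product_b (4 * m) 3)
      - theta_product_a m 3 * theta_product_b (4 * m) 3
      = 1 / 9 * ((\<Lambda> ^ 4 + 11 * \<Lambda>\<^sup>2 - 8) / \<Lambda>)"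
    unfolding ab L using r pos' s by (intro level_6_degree_4) simp_all
  ultimately show ?thesis ..
qed

end
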